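(* In homotopy type theory / univalent foundations (HoTT/UF), assume the principle of excluded middle (every type that is a proposition is either empty or pointed). Then for any two types $X$ and $Y$ (not assumed to be sets), if there is an embedding $f : X \to Y$ and an embedding $g : Y \to X$, then $X$ and $Y$ are equivalent. That is, under excluded middle, for all types $X$ and $Y$ there is a function $(X \hookrightarrow Y) \to (Y \hookrightarrow X) \to (X \simeq Y)$, where $A \hookrightarrow B$ denotes the type of embeddings of $A$ into $B$ and $A \simeq B$ the type of equivalences.
   Context: The setting is intensional Martin-Löf type theory as used in HoTT/UF (the terminology and notation of the HoTT book), including function extensionality; types are arbitrary homotopy types ($\infty$-groupoids), in arbitrary universes. A type $P$ is a proposition (or subsingleton, or truth value) if any two of its elements are equal, i.e. $\prod_{p,q:P}\, p = q$ is inhabited. Excluded middle: for every type $P$ that is a proposition, $P + \neg P$ holds (where $\neg P := P \to \mathbf{0}$). It is assumed for propositions in all universes that are needed. It is not assumed for arbitrary types. The fiber of $f : X \to Y$ over $y : Y$ is $\sum_{x:X} f(x) = y$. A map $f : X \to Y$ of arbitrary types is an embedding if it satisfies either of the following two equivalent conditions: (1) for all $x, x' : X$, the map $\operatorname{ap}(f,x,x') : (x = x') \to (f(x) = f(x'))$ is an equivalence; (2) all the fibers of $f$ are propositions. This is stronger than left-cancellability, i.e. than merely having a function $f(x) = f(x') \to x = x'$ for all $x,x'$. The type of embeddings is $X \hookrightarrow Y := \sum_{f : X \to Y} \text{is-embedding}(f)$. *)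

theory Defs
  imports Main
begin

text \<open>
  The statement is about derivability in a formal type theory, so the theory is embedded deeply:
  raw terms, and inductively defined judgements. It is the intensional Martin-Loef type theory
  of the appendix of the HoTT book: a cumulative hierarchy of Russell universes; dependent
  function types with the eta rule; dependent pair types, binary sums, the empty type, the unit
  type, the natural numbers and identity types, each with its dependent eliminator; function
  extensionality as an axiom. There is no rule for univalence, higher inductive types, uniqueness
  of identity proofs or excluded middle; whatever is derivable here stays derivable when such
  rules are added.

  Variables are de Bruijn indices. The eliminators bind, with the innermost variable (index 0)
  last:

  \<^item> \<open>IndSig (z. C) (x y. g) p\<close>
  \<^item> \<open>IndSum (z. C) (x. c) (y. d) e\<close>
  \<^item> \<open>IndEmpty (z. C) e\<close>
  \<^item> \<open>IndUnit (z. C) c u\<close>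
  \<^item> \<open>IndNat (z. C) c (n r. d) m\<close>, where \<open>r\<close> stands for the recursive value
  \<^item> \<open>IndId (x y q. C) (z. c) a b p\<close>

  \<open>TPi A B\<close>, \<open>TSig A B\<close> bind one variable in \<open>B\<close>, \<open>Lam A b\<close> binds one in \<open>b\<close>, and
  \<open>Funext A B f g\<close> binds one in \<open>B\<close>.
\<close>

datatype tm =
    Var nat
  | Univ nat
  | TPi tm tm | Lam tm tm | App tm tm
  | TSig tm tm | MkPair tm tm | IndSig tm tm tm
  | TSum tm tm | InL tm | InR tm | IndSum tm tm tm tm
  | TEmpty | IndEmpty tm tm
  | TUnit | Star | IndUnit tm tm tm
  | TNat | Ze | Su tm | IndNat tm tm tm tm
  | TId tm tm tm | Rfl tm | IndId tm tm tm tm tm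
  | Funext tm tm tm tm

subsection \<open>Renaming and simultaneous substitution\<close>

definition upr :: "(nat \<Rightarrow> nat) \<Rightarrow> nat \<Rightarrow> nat" where
  "upr r n = (case n of 0 \<Rightarrow> 0 | Suc m \<Rightarrow> Suc (r m))"

primrec ren :: "(nat \<Rightarrow> nat) \<Rightarrow> tm \<Rightarrow> tm" where
  "ren r (Var n) = Var (r n)"
| "ren r (Univ i) = Univ i"
| "ren r (TPi A B) = TPi (ren r A) (ren (upr r) B)"
| "ren r (Lam A b) = Lam (ren r A) (ren (upr r) b)"
| "ren r (App f a) = App (ren r f) (ren r a)"
| "ren r (TSig A B) = TSig (ren r A) (ren (upr r) B)"
| "ren r (MkPair a b) = MkPair (ren r a) (ren r b)"
| "ren r (IndSig C g p) = IndSig (ren (upr r) C) (ren (upr (upr r)) g) (ren r p)"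
| "ren r (TSum A B) = TSum (ren r A) (ren r B)"
| "ren r (InL a) = InL (ren r a)"
| "ren r (InR b) = InR (ren r b)"
| "ren r (IndSum C c d e) = IndSum (ren (upr r) C) (ren (upr r) c) (ren (upr r) d) (ren r e)"
| "ren r TEmpty = TEmpty"
| "ren r (IndEmpty C e) = IndEmpty (ren (upr r) C) (ren r e)"
| "ren r TUnit = TUnit"
| "ren r Star = Star"
| "ren r (IndUnit C c u) = IndUnit (ren (upr r) C) (ren r c) (ren r u)"
| "ren r TNat = TNat"
| "ren r Ze = Ze"
| "ren r (Su n) = Su (ren r n)"
| "ren r (IndNat C c d n) = IndNat (ren (upr r) C) (ren r c) (ren (upr (upr r)) d) (ren r n)"
| "ren r (TId A a b) = TId (ren r A) (ren r a) (ren r b)"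
| "ren r (Rfl a) = Rfl (ren r a)"
| "ren r (IndId C c a b p) =
     IndId (ren (upr (upr (upr r))) C) (ren (upr r) c) (ren r a) (ren r b) (ren r p)"
| "ren r (Funext A B f g) = Funext (ren r A) (ren (upr r) B) (ren r f) (ren r g)"

text \<open>\<open>wk k A\<close> is \<open>A\<close> moved under \<open>k\<close> new binders; \<open>wkb k B\<close> does the same to
  a term \<open>B\<close> with one bound variable of its own.\<close>

definition wk :: "nat \<Rightarrow> tm \<Rightarrow> tm" where
  "wk k = ren (\<lambda>n. n + k)"

definition wkb :: "nat \<Rightarrow> tm \<Rightarrow> tm" where
  "wkb k = ren (upr (\<lambda>n. n + k))"

definition scons :: "tm \<Rightarrow> (nat \<Rightarrow> tm) \<Rightarrow> nat \<Rightarrow> tm" (infixr "\<bullet>" 55) where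
  "(a \<bullet> s) n = (case n of 0 \<Rightarrow> a | Suc m \<Rightarrow> s m)"

definition shift :: "nat \<Rightarrow> nat \<Rightarrow> tm" where
  "shift k n = Var (n + k)"

definition ups :: "(nat \<Rightarrow> tm) \<Rightarrow> nat \<Rightarrow> tm" where
  "ups s = Var 0 \<bullet> (\<lambda>n. wk 1 (s n))"

primrec sub :: "(nat \<Rightarrow> tm) \<Rightarrow> tm \<Rightarrow> tm" where
  "sub s (Var n) = s n"
| "sub s (Univ i) = Univ i"
| "sub s (TPi A B) = TPi (sub s A) (sub (ups s) B)"
| "sub s (Lam A b) = Lam (sub s A) (sub (ups s) b)"
| "sub s (App f a) = App (sub s f) (sub s a)"
| "sub s (TSig A B) = TSig (sub s A) (sub (ups s) B)"
| "sub s (MkPair a b) = MkPair (sub s a) (sub s b)"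
| "sub s (IndSig C g p) = IndSig (sub (ups s) C) (sub (ups (ups s)) g) (sub s p)"
| "sub s (TSum A B) = TSum (sub s A) (sub s B)"
| "sub s (InL a) = InL (sub s a)"
| "sub s (InR b) = InR (sub s b)"
| "sub s (IndSum C c d e) = IndSum (sub (ups s) C) (sub (ups s) c) (sub (ups s) d) (sub s e)"
| "sub s TEmpty = TEmpty"
| "sub s (IndEmpty C e) = IndEmpty (sub (ups s) C) (sub s e)"
| "sub s TUnit = TUnit"
| "sub s Star = Star"
| "sub s (IndUnit C c u) = IndUnit (sub (ups s) C) (sub s c) (sub s u)"
| "sub s TNat = TNat"
| "sub s Ze = Ze"
| "sub s (Su n) = Su (sub s n)"
| "sub s (IndNat C c d n) = IndNat (sub (ups s) C) (sub s c) (sub (ups (ups s)) d) (sub s n)"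
| "sub s (TId A a b) = TId (sub s A) (sub s a) (sub s b)"
| "sub s (Rfl a) = Rfl (sub s a)"
| "sub s (IndId C c a b p) =
     IndId (sub (ups (ups (ups s))) C) (sub (ups s) c) (sub s a) (sub s b) (sub s p)"
| "sub s (Funext A B f g) = Funext (sub s A) (sub (ups s) B) (sub s f) (sub s g)"

text \<open>\<open>C[[a]]\<close> replaces variable 0 by \<open>a\<close> and lowers the other indices.\<close>

abbreviation inst :: "tm \<Rightarrow> tm \<Rightarrow> tm" ("_[[_]]" [1000, 0] 1000) where
  "C[[a]] \<equiv> sub (a \<bullet> Var) C"

subsection \<open>Defined types\<close>

definition Arr :: "tm \<Rightarrow> tm \<Rightarrow> tm" where
  "Arr A B = TPi A (wk 1 B)"

definition Prod :: "tm \<Rightarrow> tm \<Rightarrow> tm" where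
  "Prod A B = TSig A (wk 1 B)"

definition Neg :: "tm \<Rightarrow> tm" where
  "Neg A = Arr A TEmpty"

text \<open>\<open>\<Prod> p q : P. p = q\<close>\<close>

definition isProp :: "tm \<Rightarrow> tm" where
  "isProp P = TPi P (TPi (wk 1 P) (TId (wk 2 P) (Var 1) (Var 0)))"

text \<open>The fibre of \<open>f : X \<rightarrow> Y\<close> over \<open>y : Y\<close>, that is \<open>\<Sum> x : X. f x = y\<close>\<close>

definition Fib :: "tm \<Rightarrow> tm \<Rightarrow> tm \<Rightarrow> tm \<Rightarrow> tm" where
  "Fib X Y f y = TSig X (TId (wk 1 Y) (App (wk 1 f) (Var 0)) (wk 1 y))"

text \<open>All fibres are propositions: \<open>\<Prod> y : Y. isProp (Fib f y)\<close>\<close>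

definition isEmb :: "tm \<Rightarrow> tm \<Rightarrow> tm \<Rightarrow> tm" where
  "isEmb X Y f = TPi Y (isProp (Fib (wk 1 X) (wk 1 Y) (wk 1 f) (Var 0)))"

definition Emb :: "tm \<Rightarrow> tm \<Rightarrow> tm" where
  "Emb X Y = TSig (Arr X Y) (isEmb (wk 1 X) (wk 1 Y) (Var 0))"

text \<open>\<open>(\<Sum> g : B \<rightarrow> A. \<Prod> b : B. f (g b) = b) \<times> (\<Sum> h : B \<rightarrow> A. \<Prod> a : A. h (f a) = a)\<close>\<close>

definition isEquiv :: "tm \<Rightarrow> tm \<Rightarrow> tm \<Rightarrow> tm" where
  "isEquiv A B f = Prod
     (TSig (Arr B A) (TPi (wk 1 B) (TId (wk 2 B) (App (wk 2 f) (App (Var 1) (Var 0))) (Var 0))))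
     (TSig (Arr B A) (TPi (wk 1 A) (TId (wk 2 A) (App (Var 1) (App (wk 2 f) (Var 0))) (Var 0))))"

definition Equiv :: "tm \<Rightarrow> tm \<Rightarrow> tm" where
  "Equiv A B = TSig (Arr A B) (isEquiv (wk 1 A) (wk 1 B) (Var 0))"

text \<open>\<open>\<Prod> x : A. f x = g x\<close> for \<open>f, g : \<Prod> x : A. B\<close>\<close>

definition Homotopy :: "tm \<Rightarrow> tm \<Rightarrow> tm \<Rightarrow> tm \<Rightarrow> tm" where
  "Homotopy A B f g = TPi A (TId B (App (wk 1 f) (Var 0)) (App (wk 1 g) (Var 0)))"

text \<open>The canonical map from \<open>f = g\<close> to \<open>Homotopy A B f g\<close>, by path induction with the motive
  \<open>h k q. Homotopy A B h k\<close> and the base case \<open>h. \<lambda>x. refl (h x)\<close>.\<close>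

definition happly :: "tm \<Rightarrow> tm \<Rightarrow> tm \<Rightarrow> tm \<Rightarrow> tm" where
  "happly A B f g = Lam (TId (TPi A B) f g)
     (IndId (Homotopy (wk 4 A) (wkb 4 B) (Var 2) (Var 1))
            (Lam (wk 2 A) (Rfl (App (Var 1) (Var 0))))
            (wk 1 f) (wk 1 g) (Var 0))"

text \<open>Excluded middle for the propositions in the universe \<open>Univ k\<close>\<close>

definition LEM :: "nat \<Rightarrow> tm" where
  "LEM k = TPi (Univ k) (Arr (isProp (Var 0)) (TSum (Var 0) (Neg (Var 0))))"

subsection \<open>Judgements\<close>

text \<open>A context lists the types of its variables, the most recent one first, so each entry is a
  type over the entries to its right. The three judgements: \<open>\<Gamma>\<close> is a well-formed context;
  \<open>a\<close> has type \<open>A\<close>; \<open>a\<close> and \<open>b\<close> are judgementally equal of type \<open>A\<close>.\<close>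

inductive
  wfctx :: "tm list \<Rightarrow> bool" ("\<turnstile> _ ctx" [51] 50) and
  typing :: "tm list \<Rightarrow> tm \<Rightarrow> tm \<Rightarrow> bool" ("_ \<turnstile> _ \<Ztypecolon> _" [51, 51, 51] 50) and
  eqtm :: "tm list \<Rightarrow> tm \<Rightarrow> tm \<Rightarrow> tm \<Rightarrow> bool" ("_ \<turnstile> _ \<doteq> _ \<Ztypecolon> _" [51, 51, 51, 51] 50)
where
  ctx_nil: "\<turnstile> [] ctx"
| ctx_cons: "\<Gamma> \<turnstile> A \<Ztypecolon> Univ i \<Longrightarrow> \<turnstile> (A # \<Gamma>) ctx"

| var: "\<turnstile> \<Gamma> ctx \<Longrightarrow> n < length \<Gamma> \<Longrightarrow> \<Gamma> \<turnstile> Var n \<Ztypecolon> wk (Suc n) (\<Gamma> ! n)"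

| eq_refl: "\<Gamma> \<turnstile> a \<Ztypecolon> A \<Longrightarrow> \<Gamma> \<turnstile> a \<doteq> a \<Ztypecolon> A"
| eq_sym: "\<Gamma> \<turnstile> a \<doteq> b \<Ztypecolon> A \<Longrightarrow> \<Gamma> \<turnstile> b \<doteq> a \<Ztypecolon> A"
| eq_trans: "\<Gamma> \<turnstile> a \<doteq> b \<Ztypecolon> A \<Longrightarrow> \<Gamma> \<turnstile> b \<doteq> c \<Ztypecolon> A \<Longrightarrow> \<Gamma> \<turnstile> a \<doteq> c \<Ztypecolon> A"
| conv: "\<Gamma> \<turnstile> a \<Ztypecolon> A \<Longrightarrow> \<Gamma> \<turnstile> A \<doteq> B \<Ztypecolon> Univ i \<Longrightarrow> \<Gamma> \<turnstile> a \<Ztypecolon> B"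
| eq_conv: "\<Gamma> \<turnstile> a \<doteq> b \<Ztypecolon> A \<Longrightarrow> \<Gamma> \<turnstile> A \<doteq> B \<Ztypecolon> Univ i \<Longrightarrow> \<Gamma> \<turnstile> a \<doteq> b \<Ztypecolon> B"

| univ: "\<turnstile> \<Gamma> ctx \<Longrightarrow> \<Gamma> \<turnstile> Univ i \<Ztypecolon> Univ (Suc i)"
| cumul: "\<Gamma> \<turnstile> A \<Ztypecolon> Univ i \<Longrightarrow> \<Gamma> \<turnstile> A \<Ztypecolon> Univ (Suc i)"
| eq_cumul: "\<Gamma> \<turnstile> A \<doteq> B \<Ztypecolon> Univ i \<Longrightarrow> \<Gamma> \<turnstile> A \<doteq> B \<Ztypecolon> Univ (Suc i)"

| pi_form: "\<Gamma> \<turnstile> A \<Ztypecolon> Univ i \<Longrightarrow> A # \<Gamma> \<turnstile> B \<Ztypecolon> Univ i \<Longrightarrow> \<Gamma> \<turnstile> TPi A B \<Ztypecolon> Univ i"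
| pi_intro: "A # \<Gamma> \<turnstile> b \<Ztypecolon> B \<Longrightarrow> \<Gamma> \<turnstile> Lam A b \<Ztypecolon> TPi A B"
| pi_elim: "\<Gamma> \<turnstile> f \<Ztypecolon> TPi A B \<Longrightarrow> \<Gamma> \<turnstile> a \<Ztypecolon> A \<Longrightarrow> \<Gamma> \<turnstile> App f a \<Ztypecolon> B[[a]]"
| pi_beta: "A # \<Gamma> \<turnstile> b \<Ztypecolon> B \<Longrightarrow> \<Gamma> \<turnstile> a \<Ztypecolon> A \<Longrightarrow> \<Gamma> \<turnstile> App (Lam A b) a \<doteq> b[[a]] \<Ztypecolon> B[[a]]"
| pi_eta: "\<Gamma> \<turnstile> f \<Ztypecolon> TPi A B \<Longrightarrow> \<Gamma> \<turnstile> f \<doteq> Lam A (App (wk 1 f) (Var 0)) \<Ztypecolon> TPi A B"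
| pi_form_eq: "\<Gamma> \<turnstile> A \<doteq> A' \<Ztypecolon> Univ i \<Longrightarrow> A # \<Gamma> \<turnstile> B \<doteq> B' \<Ztypecolon> Univ i \<Longrightarrow>
    \<Gamma> \<turnstile> TPi A B \<doteq> TPi A' B' \<Ztypecolon> Univ i"
| pi_intro_eq: "\<Gamma> \<turnstile> A \<doteq> A' \<Ztypecolon> Univ i \<Longrightarrow> A # \<Gamma> \<turnstile> b \<doteq> b' \<Ztypecolon> B \<Longrightarrow>
    \<Gamma> \<turnstile> Lam A b \<doteq> Lam A' b' \<Ztypecolon> TPi A B"
| pi_elim_eq: "\<Gamma> \<turnstile> f \<doteq> f' \<Ztypecolon> TPi A B \<Longrightarrow> \<Gamma> \<turnstile> a \<doteq> a' \<Ztypecolon> A \<Longrightarrow>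
    \<Gamma> \<turnstile> App f a \<doteq> App f' a' \<Ztypecolon> B[[a]]"

| sig_form: "\<Gamma> \<turnstile> A \<Ztypecolon> Univ i \<Longrightarrow> A # \<Gamma> \<turnstile> B \<Ztypecolon> Univ i \<Longrightarrow> \<Gamma> \<turnstile> TSig A B \<Ztypecolon> Univ i"
| sig_intro: "A # \<Gamma> \<turnstile> B \<Ztypecolon> Univ i \<Longrightarrow> \<Gamma> \<turnstile> a \<Ztypecolon> A \<Longrightarrow> \<Gamma> \<turnstile> b \<Ztypecolon> B[[a]] \<Longrightarrow>
    \<Gamma> \<turnstile> MkPair a b \<Ztypecolon> TSig A B"
| sig_elim: "TSig A B # \<Gamma> \<turnstile> C \<Ztypecolon> Univ i \<Longrightarrow>
    B # A # \<Gamma> \<turnstile> g \<Ztypecolon> sub (MkPair (Var 1) (Var 0) \<bullet> shift 2) C \<Longrightarrow>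
    \<Gamma> \<turnstile> p \<Ztypecolon> TSig A B \<Longrightarrow>
    \<Gamma> \<turnstile> IndSig C g p \<Ztypecolon> C[[p]]"
| sig_beta: "TSig A B # \<Gamma> \<turnstile> C \<Ztypecolon> Univ i \<Longrightarrow>
    B # A # \<Gamma> \<turnstile> g \<Ztypecolon> sub (MkPair (Var 1) (Var 0) \<bullet> shift 2) C \<Longrightarrow>
    \<Gamma> \<turnstile> a \<Ztypecolon> A \<Longrightarrow> \<Gamma> \<turnstile> b \<Ztypecolon> B[[a]] \<Longrightarrow>
    \<Gamma> \<turnstile> IndSig C g (MkPair a b) \<doteq> sub (b \<bullet> a \<bullet> Var) g \<Ztypecolon> C[[MkPair a b]]"
| sig_form_eq: "\<Gamma> \<turnstile> A \<doteq> A' \<Ztypecolon> Univ i \<Longrightarrow> A # \<Gamma> \<turnstile> B \<doteq> B' \<Ztypecolon> Univ i \<Longrightarrow>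
    \<Gamma> \<turnstile> TSig A B \<doteq> TSig A' B' \<Ztypecolon> Univ i"
| sig_intro_eq: "A # \<Gamma> \<turnstile> B \<Ztypecolon> Univ i \<Longrightarrow> \<Gamma> \<turnstile> a \<doteq> a' \<Ztypecolon> A \<Longrightarrow> \<Gamma> \<turnstile> b \<doteq> b' \<Ztypecolon> B[[a]] \<Longrightarrow>
    \<Gamma> \<turnstile> MkPair a b \<doteq> MkPair a' b' \<Ztypecolon> TSig A B"
| sig_elim_eq: "TSig A B # \<Gamma> \<turnstile> C \<doteq> C' \<Ztypecolon> Univ i \<Longrightarrow>
    B # A # \<Gamma> \<turnstile> g \<doteq> g' \<Ztypecolon> sub (MkPair (Var 1) (Var 0) \<bullet> shift 2) C \<Longrightarrow>
    \<Gamma> \<turnstile> p \<doteq> p' \<Ztypecolon> TSig A B \<Longrightarrow>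
    \<Gamma> \<turnstile> IndSig C g p \<doteq> IndSig C' g' p' \<Ztypecolon> C[[p]]"

| sum_form: "\<Gamma> \<turnstile> A \<Ztypecolon> Univ i \<Longrightarrow> \<Gamma> \<turnstile> B \<Ztypecolon> Univ i \<Longrightarrow> \<Gamma> \<turnstile> TSum A B \<Ztypecolon> Univ i"
| sum_intro1: "\<Gamma> \<turnstile> A \<Ztypecolon> Univ i \<Longrightarrow> \<Gamma> \<turnstile> B \<Ztypecolon> Univ i \<Longrightarrow> \<Gamma> \<turnstile> a \<Ztypecolon> A \<Longrightarrow> \<Gamma> \<turnstile> InL a \<Ztypecolon> TSum A B"
| sum_intro2: "\<Gamma> \<turnstile> A \<Ztypecolon> Univ i \<Longrightarrow> \<Gamma> \<turnstile> B \<Ztypecolon> Univ i \<Longrightarrow> \<Gamma> \<turnstile> b \<Ztypecolon> B \<Longrightarrow> \<Gamma> \<turnstile> InR b \<Ztypecolon> TSum A B"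
| sum_elim: "TSum A B # \<Gamma> \<turnstile> C \<Ztypecolon> Univ i \<Longrightarrow>
    A # \<Gamma> \<turnstile> c \<Ztypecolon> sub (InL (Var 0) \<bullet> shift 1) C \<Longrightarrow>
    B # \<Gamma> \<turnstile> d \<Ztypecolon> sub (InR (Var 0) \<bullet> shift 1) C \<Longrightarrow>
    \<Gamma> \<turnstile> e \<Ztypecolon> TSum A B \<Longrightarrow>
    \<Gamma> \<turnstile> IndSum C c d e \<Ztypecolon> C[[e]]"
| sum_beta1: "TSum A B # \<Gamma> \<turnstile> C \<Ztypecolon> Univ i \<Longrightarrow>
    A # \<Gamma> \<turnstile> c \<Ztypecolon> sub (InL (Var 0) \<bullet> shift 1) C \<Longrightarrow>
    B # \<Gamma> \<turnstile> d \<Ztypecolon> sub (InR (Var 0) \<bullet> shift 1) C \<Longrightarrow>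
    \<Gamma> \<turnstile> a \<Ztypecolon> A \<Longrightarrow>
    \<Gamma> \<turnstile> IndSum C c d (InL a) \<doteq> c[[a]] \<Ztypecolon> C[[InL a]]"
| sum_beta2: "TSum A B # \<Gamma> \<turnstile> C \<Ztypecolon> Univ i \<Longrightarrow>
    A # \<Gamma> \<turnstile> c \<Ztypecolon> sub (InL (Var 0) \<bullet> shift 1) C \<Longrightarrow>
    B # \<Gamma> \<turnstile> d \<Ztypecolon> sub (InR (Var 0) \<bullet> shift 1) C \<Longrightarrow>
    \<Gamma> \<turnstile> b \<Ztypecolon> B \<Longrightarrow>
    \<Gamma> \<turnstile> IndSum C c d (InR b) \<doteq> d[[b]] \<Ztypecolon> C[[InR b]]"
| sum_form_eq: "\<Gamma> \<turnstile> A \<doteq> A' \<Ztypecolon> Univ i \<Longrightarrow> \<Gamma> \<turnstile> B \<doteq> B' \<Ztypecolon> Univ i \<Longrightarrow>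
    \<Gamma> \<turnstile> TSum A B \<doteq> TSum A' B' \<Ztypecolon> Univ i"
| sum_intro1_eq: "\<Gamma> \<turnstile> A \<Ztypecolon> Univ i \<Longrightarrow> \<Gamma> \<turnstile> B \<Ztypecolon> Univ i \<Longrightarrow> \<Gamma> \<turnstile> a \<doteq> a' \<Ztypecolon> A \<Longrightarrow>
    \<Gamma> \<turnstile> InL a \<doteq> InL a' \<Ztypecolon> TSum A B"
| sum_intro2_eq: "\<Gamma> \<turnstile> A \<Ztypecolon> Univ i \<Longrightarrow> \<Gamma> \<turnstile> B \<Ztypecolon> Univ i \<Longrightarrow> \<Gamma> \<turnstile> b \<doteq> b' \<Ztypecolon> B \<Longrightarrow>
    \<Gamma> \<turnstile> InR b \<doteq> InR b' \<Ztypecolon> TSum A B"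
| sum_elim_eq: "TSum A B # \<Gamma> \<turnstile> C \<doteq> C' \<Ztypecolon> Univ i \<Longrightarrow>
    A # \<Gamma> \<turnstile> c \<doteq> c' \<Ztypecolon> sub (InL (Var 0) \<bullet> shift 1) C \<Longrightarrow>
    B # \<Gamma> \<turnstile> d \<doteq> d' \<Ztypecolon> sub (InR (Var 0) \<bullet> shift 1) C \<Longrightarrow>
    \<Gamma> \<turnstile> e \<doteq> e' \<Ztypecolon> TSum A B \<Longrightarrow>
    \<Gamma> \<turnstile> IndSum C c d e \<doteq> IndSum C' c' d' e' \<Ztypecolon> C[[e]]"

| empty_form: "\<turnstile> \<Gamma> ctx \<Longrightarrow> \<Gamma> \<turnstile> TEmpty \<Ztypecolon> Univ i"
| empty_elim: "TEmpty # \<Gamma> \<turnstile> C \<Ztypecolon> Univ i \<Longrightarrow> \<Gamma> \<turnstile> e \<Ztypecolon> TEmpty \<Longrightarrow> \<Gamma> \<turnstile> IndEmpty C e \<Ztypecolon> C[[e]]"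
| empty_elim_eq: "TEmpty # \<Gamma> \<turnstile> C \<doteq> C' \<Ztypecolon> Univ i \<Longrightarrow> \<Gamma> \<turnstile> e \<doteq> e' \<Ztypecolon> TEmpty \<Longrightarrow>
    \<Gamma> \<turnstile> IndEmpty C e \<doteq> IndEmpty C' e' \<Ztypecolon> C[[e]]"

| unit_form: "\<turnstile> \<Gamma> ctx \<Longrightarrow> \<Gamma> \<turnstile> TUnit \<Ztypecolon> Univ i"
| unit_intro: "\<turnstile> \<Gamma> ctx \<Longrightarrow> \<Gamma> \<turnstile> Star \<Ztypecolon> TUnit"
| unit_elim: "TUnit # \<Gamma> \<turnstile> C \<Ztypecolon> Univ i \<Longrightarrow> \<Gamma> \<turnstile> c \<Ztypecolon> C[[Star]] \<Longrightarrow> \<Gamma> \<turnstile> u \<Ztypecolon> TUnit \<Longrightarrow>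
    \<Gamma> \<turnstile> IndUnit C c u \<Ztypecolon> C[[u]]"
| unit_beta: "TUnit # \<Gamma> \<turnstile> C \<Ztypecolon> Univ i \<Longrightarrow> \<Gamma> \<turnstile> c \<Ztypecolon> C[[Star]] \<Longrightarrow>
    \<Gamma> \<turnstile> IndUnit C c Star \<doteq> c \<Ztypecolon> C[[Star]]"
| unit_elim_eq: "TUnit # \<Gamma> \<turnstile> C \<doteq> C' \<Ztypecolon> Univ i \<Longrightarrow> \<Gamma> \<turnstile> c \<doteq> c' \<Ztypecolon> C[[Star]] \<Longrightarrow>
    \<Gamma> \<turnstile> u \<doteq> u' \<Ztypecolon> TUnit \<Longrightarrow>
    \<Gamma> \<turnstile> IndUnit C c u \<doteq> IndUnit C' c' u' \<Ztypecolon> C[[u]]"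

| nat_form: "\<turnstile> \<Gamma> ctx \<Longrightarrow> \<Gamma> \<turnstile> TNat \<Ztypecolon> Univ i"
| nat_intro1: "\<turnstile> \<Gamma> ctx \<Longrightarrow> \<Gamma> \<turnstile> Ze \<Ztypecolon> TNat"
| nat_intro2: "\<Gamma> \<turnstile> n \<Ztypecolon> TNat \<Longrightarrow> \<Gamma> \<turnstile> Su n \<Ztypecolon> TNat"
| nat_elim: "TNat # \<Gamma> \<turnstile> C \<Ztypecolon> Univ i \<Longrightarrow>
    \<Gamma> \<turnstile> c \<Ztypecolon> C[[Ze]] \<Longrightarrow>
    C # TNat # \<Gamma> \<turnstile> d \<Ztypecolon> sub (Su (Var 1) \<bullet> shift 2) C \<Longrightarrow>
    \<Gamma> \<turnstile> n \<Ztypecolon> TNat \<Longrightarrow>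
    \<Gamma> \<turnstile> IndNat C c d n \<Ztypecolon> C[[n]]"
| nat_beta1: "TNat # \<Gamma> \<turnstile> C \<Ztypecolon> Univ i \<Longrightarrow>
    \<Gamma> \<turnstile> c \<Ztypecolon> C[[Ze]] \<Longrightarrow>
    C # TNat # \<Gamma> \<turnstile> d \<Ztypecolon> sub (Su (Var 1) \<bullet> shift 2) C \<Longrightarrow>
    \<Gamma> \<turnstile> IndNat C c d Ze \<doteq> c \<Ztypecolon> C[[Ze]]"
| nat_beta2: "TNat # \<Gamma> \<turnstile> C \<Ztypecolon> Univ i \<Longrightarrow>
    \<Gamma> \<turnstile> c \<Ztypecolon> C[[Ze]] \<Longrightarrow>
    C # TNat # \<Gamma> \<turnstile> d \<Ztypecolon> sub (Su (Var 1) \<bullet> shift 2) C \<Longrightarrow>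
    \<Gamma> \<turnstile> n \<Ztypecolon> TNat \<Longrightarrow>
    \<Gamma> \<turnstile> IndNat C c d (Su n) \<doteq> sub (IndNat C c d n \<bullet> n \<bullet> Var) d \<Ztypecolon> C[[Su n]]"
| nat_intro2_eq: "\<Gamma> \<turnstile> n \<doteq> n' \<Ztypecolon> TNat \<Longrightarrow> \<Gamma> \<turnstile> Su n \<doteq> Su n' \<Ztypecolon> TNat"
| nat_elim_eq: "TNat # \<Gamma> \<turnstile> C \<doteq> C' \<Ztypecolon> Univ i \<Longrightarrow>
    \<Gamma> \<turnstile> c \<doteq> c' \<Ztypecolon> C[[Ze]] \<Longrightarrow>
    C # TNat # \<Gamma> \<turnstile> d \<doteq> d' \<Ztypecolon> sub (Su (Var 1) \<bullet> shift 2) C \<Longrightarrow>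
    \<Gamma> \<turnstile> n \<doteq> n' \<Ztypecolon> TNat \<Longrightarrow>
    \<Gamma> \<turnstile> IndNat C c d n \<doteq> IndNat C' c' d' n' \<Ztypecolon> C[[n]]"

| id_form: "\<Gamma> \<turnstile> A \<Ztypecolon> Univ i \<Longrightarrow> \<Gamma> \<turnstile> a \<Ztypecolon> A \<Longrightarrow> \<Gamma> \<turnstile> b \<Ztypecolon> A \<Longrightarrow> \<Gamma> \<turnstile> TId A a b \<Ztypecolon> Univ i"
| id_intro: "\<Gamma> \<turnstile> A \<Ztypecolon> Univ i \<Longrightarrow> \<Gamma> \<turnstile> a \<Ztypecolon> A \<Longrightarrow> \<Gamma> \<turnstile> Rfl a \<Ztypecolon> TId A a a"
| id_elim: "TId (wk 2 A) (Var 1) (Var 0) # wk 1 A # A # \<Gamma> \<turnstile> C \<Ztypecolon> Univ i \<Longrightarrow>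
    A # \<Gamma> \<turnstile> c \<Ztypecolon> sub (Rfl (Var 0) \<bullet> Var 0 \<bullet> Var 0 \<bullet> shift 1) C \<Longrightarrow>
    \<Gamma> \<turnstile> a \<Ztypecolon> A \<Longrightarrow> \<Gamma> \<turnstile> b \<Ztypecolon> A \<Longrightarrow> \<Gamma> \<turnstile> p \<Ztypecolon> TId A a b \<Longrightarrow>
    \<Gamma> \<turnstile> IndId C c a b p \<Ztypecolon> sub (p \<bullet> b \<bullet> a \<bullet> Var) C"
| id_beta: "TId (wk 2 A) (Var 1) (Var 0) # wk 1 A # A # \<Gamma> \<turnstile> C \<Ztypecolon> Univ i \<Longrightarrow>
    A # \<Gamma> \<turnstile> c \<Ztypecolon> sub (Rfl (Var 0) \<bullet> Var 0 \<bullet> Var 0 \<bullet> shift 1) C \<Longrightarrow>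
    \<Gamma> \<turnstile> a \<Ztypecolon> A \<Longrightarrow>
    \<Gamma> \<turnstile> IndId C c a a (Rfl a) \<doteq> c[[a]] \<Ztypecolon> sub (Rfl a \<bullet> a \<bullet> a \<bullet> Var) C"
| id_form_eq: "\<Gamma> \<turnstile> A \<doteq> A' \<Ztypecolon> Univ i \<Longrightarrow> \<Gamma> \<turnstile> a \<doteq> a' \<Ztypecolon> A \<Longrightarrow> \<Gamma> \<turnstile> b \<doteq> b' \<Ztypecolon> A \<Longrightarrow>
    \<Gamma> \<turnstile> TId A a b \<doteq> TId A' a' b' \<Ztypecolon> Univ i"
| id_intro_eq: "\<Gamma> \<turnstile> A \<Ztypecolon> Univ i \<Longrightarrow> \<Gamma> \<turnstile> a \<doteq> a' \<Ztypecolon> A \<Longrightarrow> \<Gamma> \<turnstile> Rfl a \<doteq> Rfl a' \<Ztypecolon> TId A a a"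
| id_elim_eq: "TId (wk 2 A) (Var 1) (Var 0) # wk 1 A # A # \<Gamma> \<turnstile> C \<doteq> C' \<Ztypecolon> Univ i \<Longrightarrow>
    A # \<Gamma> \<turnstile> c \<doteq> c' \<Ztypecolon> sub (Rfl (Var 0) \<bullet> Var 0 \<bullet> Var 0 \<bullet> shift 1) C \<Longrightarrow>
    \<Gamma> \<turnstile> a \<doteq> a' \<Ztypecolon> A \<Longrightarrow> \<Gamma> \<turnstile> b \<doteq> b' \<Ztypecolon> A \<Longrightarrow> \<Gamma> \<turnstile> p \<doteq> p' \<Ztypecolon> TId A a b \<Longrightarrow>
    \<Gamma> \<turnstile> IndId C c a b p \<doteq> IndId C' c' a' b' p' \<Ztypecolon> sub (p \<bullet> b \<bullet> a \<bullet> Var) C"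

| funext: "\<Gamma> \<turnstile> A \<Ztypecolon> Univ i \<Longrightarrow> A # \<Gamma> \<turnstile> B \<Ztypecolon> Univ i \<Longrightarrow>
    \<Gamma> \<turnstile> f \<Ztypecolon> TPi A B \<Longrightarrow> \<Gamma> \<turnstile> g \<Ztypecolon> TPi A B \<Longrightarrow>
    \<Gamma> \<turnstile> Funext A B f g \<Ztypecolon> isEquiv (TId (TPi A B) f g) (Homotopy A B f g) (happly A B f g)"
| funext_eq: "\<Gamma> \<turnstile> A \<doteq> A' \<Ztypecolon> Univ i \<Longrightarrow> A # \<Gamma> \<turnstile> B \<doteq> B' \<Ztypecolon> Univ i \<Longrightarrow>
    \<Gamma> \<turnstile> f \<doteq> f' \<Ztypecolon> TPi A B \<Longrightarrow> \<Gamma> \<turnstile> g \<doteq> g' \<Ztypecolon> TPi A B \<Longrightarrow>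
    \<Gamma> \<turnstile> Funext A B f g \<doteq> Funext A' B' f' g' \<Ztypecolon>
      isEquiv (TId (TPi A B) f g) (Homotopy A B f g) (happly A B f g)"

end

theory Submission
  imports Defs
begin

text \<open>
  The Cantor-Schroeder-Bernstein theorem for homotopy types, derived inside the type theory. Given
  embeddings \<open>f : X \<rightarrow> Y\<close> and \<open>g : Y \<rightarrow> X\<close>, call \<open>x : X\<close> a \<open>g\<close>-point if every \<open>x0\<close> with
  \<open>(g f)^n x0 = x\<close> for some \<open>n\<close> lies in the image of \<open>g\<close>. The fibres of \<open>g\<close> are propositions, so by
  function extensionality being a \<open>g\<close>-point is a proposition, and excluded middle decides it. It
  lives in the universe of excluded middle because it is built from \<open>X\<close>, \<open>Y\<close> and the natural
  numbers only. Relate \<open>x\<close> to \<open>y\<close> if either \<open>x\<close> is a \<open>g\<close>-point and \<open>g y = x\<close>, or it is not one and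
  \<open>f x = y\<close>.

  This relation is a one-to-one correspondence. Totality on the left uses \<open>n = 0\<close>: a \<open>g\<close>-point is in the
  image of \<open>g\<close>. That \<open>y\<close> is determined by \<open>x\<close> uses left-cancellability of \<open>g\<close>; that \<open>x\<close> is
  determined by \<open>y\<close> uses left-cancellability of \<open>f\<close>, and, for two \<open>x\<close> of different kinds, the fact
  that \<open>x\<close> is a \<open>g\<close>-point if \<open>g (f x)\<close> is (\<open>isG_of_isG_gf\<close>). Totality on the right is the
  interesting part. If \<open>g y\<close> is a \<open>g\<close>-point, then \<open>y\<close> is related to it. If not, then \<open>y\<close> is
  related to an \<open>x\<close> that is not a \<open>g\<close>-point and has \<open>f x = y\<close>. This rests on
  \<open>isG_g_of_preimages_G\<close>: if all \<open>f\<close>-preimages of \<open>y\<close> are \<open>g\<close>-points, so is \<open>g y\<close>. Hence the fibre of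
  \<open>f\<close> over \<open>y\<close> cannot be empty; being a proposition it is inhabited, by excluded middle; and its
  point is not a \<open>g\<close>-point, because all preimages of \<open>y\<close> are equal to it. Finally, type-theoretic
  choice turns the correspondence into two mutually inverse functions.

  Most of the argument is insensitive to which terms inhabit the types involved, so it is phrased
  for \<open>\<Gamma> \<TTurnstile> A\<close>, \<open>A\<close> has an element over \<open>\<Gamma>\<close>, and natural deduction rules for this judgement are
  derived. Dependent pairs are decomposed by \<open>obtain\<close>: the first component is an explicit term over
  the same context. The main argument introduces hypotheses over an arbitrary weakening \<open>\<Delta>\<close> of
  \<open>\<Gamma>\<close>, in the manner of Kripke semantics. All this rests on the stability of the judgements under
  renaming of variables (\<open>renaming\<close>).
\<close>

section \<open>Calculus of renamings and substitutions\<close>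

text \<open>The simplifier expresses weakening by iterated \<open>ren Suc\<close> and moves it to the leaves, where it
  cancels against substitutions. A term with a bound variable of its own is weakened by \<open>ren (upr Suc)\<close>.\<close>
abbreviation lift :: "tm \<Rightarrow> tm" ("\<up>_" [1000] 1000) where
  "\<up>t \<equiv> ren Suc t"

lemma upr_simps [simp]:
  "upr r 0 = 0" "upr r (Suc n) = Suc (r n)"
  "upr r (numeral m) = Suc (r (pred_numeral m))"
  by (simp_all add: upr_def numeral_eq_Suc)

lemma scons_simps [simp]:
  "(a \<bullet> s) 0 = a" "(a \<bullet> s) (Suc n) = s n"
  "(a \<bullet> s) (numeral m) = s (pred_numeral m)"
  by (simp_all add: scons_def numeral_eq_Suc)

lemma wk_lift [simp]:
  "wk (Suc 0) t = \<up>t"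
  by (simp add: wk_def)

lemma ups_simps [simp]:
  "ups s 0 = Var 0" "ups s (Suc n) = \<up>(s n)"
  "ups s (numeral m) = \<up>(s (pred_numeral m))"
  by (simp_all add: ups_def)

lemma upr_comp: "(\<lambda>n. upr r (upr q n)) = upr (\<lambda>n. r (q n))"
proof
  show "upr r (upr q n) = upr (\<lambda>n. r (q n)) n" for n
    by (cases n) simp_all
qed

lemma ren_ren: "ren r (ren q t) = ren (\<lambda>n. r (q n)) t"
  by (induction t arbitrary: r q) (simp_all add: upr_comp)

lemma ups_upr: "(\<lambda>n. ups s (upr q n)) = ups (\<lambda>n. s (q n))"
proof
  show "ups s (upr q n) = ups (\<lambda>n. s (q n)) n" for n
    by (cases n) simp_all
qed

lemma sub_ren: "sub s (ren q t) = sub (\<lambda>n. s (q n)) t"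
  by (induction t arbitrary: s q) (simp_all add: ups_upr)

lemma ren_ups: "(\<lambda>n. ren (upr r) (ups s n)) = ups (\<lambda>n. ren r (s n))"
proof
  show "ren (upr r) (ups s n) = ups (\<lambda>n. ren r (s n)) n" for n
    by (cases n) (simp_all add: ren_ren)
qed

lemma ren_sub: "ren r (sub s t) = sub (\<lambda>n. ren r (s n)) t"
  by (induction t arbitrary: s r) (simp_all add: ren_ups)

lemma ups_Var [simp]: "ups Var = Var"
proof
  show "ups Var n = Var n" for n
    by (cases n) simp_all
qed

lemma sub_Var [simp]: "sub Var t = t"
  by (induction t) simp_all

lemma ups_ren: "ups (\<lambda>n. Var (r n)) = (\<lambda>n. Var (upr r n))"
proof
  show "ups (\<lambda>n. Var (r n)) n = Var (upr r n)" for n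
    by (cases n) simp_all
qed

lemma ren_as_sub: "ren r t = sub (\<lambda>n. Var (r n)) t"
  by (induction t arbitrary: r) (simp_all add: ups_ren)

lemma wk_lifts [simp]:
  "wk 2 t = \<up>\<up>t" "wk (Suc (Suc 0)) t = \<up>\<up>t"
  by (simp_all add: wk_def ren_ren numeral_eq_Suc)

lemma wk_4: "wk 4 t = \<up>\<up>\<up>\<up>t"
  by (simp_all add: wk_def ren_ren numeral_eq_Suc)

lemma wkb_lift [simp]: "wkb (Suc 0) t = ren (upr Suc) t"
  by (simp add: wkb_def)

lemma wkb_4: "wkb 4 t = ren (upr Suc) (ren (upr Suc) (ren (upr Suc) (ren (upr Suc) t)))"
  by (simp add: wkb_def ren_ren upr_comp numeral_eq_Suc)

lemma ren_upr_lift [simp]: "ren (upr r) \<up>t = \<up>(ren r t)"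
  by (simp add: ren_ren)

lemma sub_ups_lift [simp]: "sub (ups s) \<up>t = \<up>(sub s t)"
  by (simp add: sub_ren ren_sub)

lemma sub_scons_lift [simp]: "sub (a \<bullet> s) \<up>t = sub s t"
  by (simp add: sub_ren)

lemma sub_shift [simp]:
  "sub (shift (Suc 0)) t = \<up>t" "sub (shift 2) t = \<up>\<up>t"
  by (simp_all add: ren_ren) (simp_all add: ren_as_sub shift_def [abs_def])

lemma sub_cong: "(\<And>n. s n = s' n) \<Longrightarrow> sub s t = sub s' t"
  by (metis ext)

text \<open>The substitutions in the typing rules have six shapes; the following lemmas commute a renaming
  with each of them.\<close>
lemma ren_inst: "ren r (sub (a \<bullet> Var) t) = sub (ren r a \<bullet> Var) (ren (upr r) t)"
  unfolding ren_sub sub_ren by (rule sub_cong) (simp add: scons_def upr_def split: nat.split)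

lemma ren_inst2: "ren r (sub (b \<bullet> a \<bullet> Var) t) =
   sub (ren r b \<bullet> ren r a \<bullet> Var) (ren (upr (upr r)) t)"
  unfolding ren_sub sub_ren by (rule sub_cong) (simp add: scons_def upr_def split: nat.split)

lemma ren_inst3: "ren r (sub (c \<bullet> b \<bullet> a \<bullet> Var) t) =
   sub (ren r c \<bullet> ren r b \<bullet> ren r a \<bullet> Var) (ren (upr (upr (upr r))) t)"
  unfolding ren_sub sub_ren by (rule sub_cong) (simp add: scons_def upr_def split: nat.split)

lemma ren_inst_shift1: "ren (upr r) (sub (a \<bullet> shift 1) t) =
   sub (ren (upr r) a \<bullet> shift 1) (ren (upr r) t)"
  unfolding ren_sub sub_ren by (rule sub_cong) (simp add: scons_def shift_def upr_def split: nat.split)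

lemma ren_inst_shift2: "ren (upr (upr r)) (sub (a \<bullet> shift 2) t) =
   sub (ren (upr (upr r)) a \<bullet> shift 2) (ren (upr r) t)"
  unfolding ren_sub sub_ren by (rule sub_cong) (simp add: scons_def shift_def numeral_eq_Suc upr_def split: nat.split)

lemma ren_inst3_shift1: "ren (upr r) (sub (c \<bullet> b \<bullet> a \<bullet> shift 1) t) =
   sub (ren (upr r) c \<bullet> ren (upr r) b \<bullet> ren (upr r) a \<bullet> shift 1) (ren (upr (upr (upr r))) t)"
  unfolding ren_sub sub_ren by (rule sub_cong) (simp add: scons_def shift_def upr_def split: nat.split)

lemmas ren_insts = ren_inst ren_inst2 ren_inst3 ren_inst_shift1 ren_inst_shift2 ren_inst3_shift1

lemma ren_defs [simp]:
  "ren r (Arr A B) = Arr (ren r A) (ren r B)"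
  "ren r (Prod A B) = Prod (ren r A) (ren r B)"
  "ren r (Neg A) = Neg (ren r A)"
  "ren r (isProp A) = isProp (ren r A)"
  "ren r (Fib X Y f y) = Fib (ren r X) (ren r Y) (ren r f) (ren r y)"
  "ren r (isEmb X Y f) = isEmb (ren r X) (ren r Y) (ren r f)"
  "ren r (Emb X Y) = Emb (ren r X) (ren r Y)"
  "ren r (isEquiv X Y f) = isEquiv (ren r X) (ren r Y) (ren r f)"
  "ren r (Equiv X Y) = Equiv (ren r X) (ren r Y)"
  "ren r (LEM k) = LEM k"
  by (simp_all add: Arr_def Prod_def Neg_def isProp_def Fib_def isEmb_def Emb_def isEquiv_def
     Equiv_def LEM_def)

lemma ren_Homotopy [simp]: "ren r (Homotopy A B f g) = Homotopy (ren r A) (ren (upr r) B) (ren r f) (ren r g)"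
  by (simp add: Homotopy_def)

lemma ren_upr_upr_lift [simp]: "ren (upr (upr r)) (ren (upr Suc) t) = ren (upr Suc) (ren (upr r) t)"
  by (simp add: ren_ren upr_comp)

lemma ren_happly [simp]: "ren r (happly A B f g) = happly (ren r A) (ren (upr r) B) (ren r f) (ren r g)"
  by (simp add: happly_def wk_4 wkb_4) (simp add: numeral_eq_Suc)

lemma sub_defs [simp]:
  "sub s (Arr A B) = Arr (sub s A) (sub s B)"
  "sub s (Prod A B) = Prod (sub s A) (sub s B)"
  "sub s (Neg A) = Neg (sub s A)"
  "sub s (isProp A) = isProp (sub s A)"
  "sub s (Fib X Y f y) = Fib (sub s X) (sub s Y) (sub s f) (sub s y)"
  "sub s (isEmb X Y f) = isEmb (sub s X) (sub s Y) (sub s f)"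
  "sub s (Emb X Y) = Emb (sub s X) (sub s Y)"
  "sub s (isEquiv X Y f) = isEquiv (sub s X) (sub s Y) (sub s f)"
  "sub s (Equiv X Y) = Equiv (sub s X) (sub s Y)"
  "sub s (LEM k) = LEM k"
  by (simp_all add: Arr_def Prod_def Neg_def isProp_def Fib_def isEmb_def Emb_def isEquiv_def
     Equiv_def LEM_def)

section \<open>Stability of the judgements under renaming\<close>

definition ctx_renaming :: "(nat \<Rightarrow> nat) \<Rightarrow> tm list \<Rightarrow> tm list \<Rightarrow> bool" where
  "ctx_renaming r \<Gamma> \<Delta> \<longleftrightarrow> (\<forall>n<length \<Gamma>. r n < length \<Delta> \<and>
     ren r (wk (Suc n) (\<Gamma> ! n)) = wk (Suc (r n)) (\<Delta> ! r n))"

lemma wk_Suc_Suc: "wk (Suc (Suc n)) t = \<up>(wk (Suc n) t)"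
  by (simp add: wk_def ren_ren)

lemma ctx_renaming_upr: "ctx_renaming r \<Gamma> \<Delta> \<Longrightarrow> ctx_renaming (upr r) (A # \<Gamma>) (ren r A # \<Delta>)"
  by (auto simp: ctx_renaming_def wk_Suc_Suc less_Suc_eq_0_disj)

lemma ctx_renaming_Suc: "ctx_renaming Suc \<Gamma> (A # \<Gamma>)"
  by (auto simp: ctx_renaming_def wk_Suc_Suc)

text \<open>Some rules, such as \<open>pi_intro\<close>, extend the context by \<open>A\<close> without a premise that \<open>A\<close> is a type.
  An induction on derivations then offers no hypothesis that makes the renamed extended context
  well-formed. So the induction carries along that every entry of the context remains a type under
  renaming; the hypothesis for a premise over \<open>A # \<Gamma>\<close> supplies this for \<open>A\<close>.\<close>
primrec entries_stable :: "tm list \<Rightarrow> bool" where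
  "entries_stable [] = True"
| "entries_stable (A # \<Gamma>) = (entries_stable \<Gamma> \<and>
    (\<forall>\<Delta> r. \<turnstile> \<Delta> ctx \<longrightarrow> ctx_renaming r \<Gamma> \<Delta> \<longrightarrow> (\<exists>i. \<Delta> \<turnstile> ren r A \<Ztypecolon> Univ i)))"

text \<open>The induction predicate: a property \<open>P\<close> of renamings out of \<open>\<Gamma>\<close> holds at all of them.\<close>
definition renaming_stable :: "tm list \<Rightarrow> (tm list \<Rightarrow> (nat \<Rightarrow> nat) \<Rightarrow> bool) \<Rightarrow> bool" where
  "renaming_stable \<Gamma> P \<longleftrightarrow> entries_stable \<Gamma> \<and> (\<forall>\<Delta> r. \<turnstile> \<Delta> ctx \<longrightarrow> ctx_renaming r \<Gamma> \<Delta> \<longrightarrow> P \<Delta> r)"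

text \<open>Reduces a premise over an extended context to the context of the conclusion, so that all
  induction hypotheses of a rule speak of the same renaming.\<close>
lemma stable_peel: "renaming_stable (A # \<Gamma>) P \<Longrightarrow> renaming_stable \<Gamma> (\<lambda>\<Delta> r. P (ren r A # \<Delta>) (upr r))"
proof (unfold renaming_stable_def, intro conjI allI impI; (elim conjE)?)
  assume "entries_stable (A # \<Gamma>)" then show "entries_stable \<Gamma>" by simp
next
  fix \<Delta> r
  assume g: "entries_stable (A # \<Gamma>)" and P: "\<forall>\<Delta> r. \<turnstile> \<Delta> ctx \<longrightarrow> ctx_renaming r (A # \<Gamma>) \<Delta> \<longrightarrow> P \<Delta> r"
    and \<Delta>: "\<turnstile> \<Delta> ctx" and r: "ctx_renaming r \<Gamma> \<Delta>"
  from g \<Delta> r have "\<turnstile> (ren r A # \<Delta>) ctx" by (auto intro: ctx_cons)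
  then show "P (ren r A # \<Delta>) (upr r)" using P ctx_renaming_upr[OF r] by blast
qed

lemma stable_entries: "renaming_stable \<Gamma> P \<Longrightarrow> entries_stable \<Gamma>"
  by (simp add: renaming_stable_def)

lemma stableI: "entries_stable \<Gamma> \<Longrightarrow> (\<And>\<Delta> r. \<turnstile> \<Delta> ctx \<Longrightarrow> ctx_renaming r \<Gamma> \<Delta> \<Longrightarrow> P \<Delta> r) \<Longrightarrow> renaming_stable \<Gamma> P"
  by (simp add: renaming_stable_def)

lemma stableD: "renaming_stable \<Gamma> P \<Longrightarrow> \<turnstile> \<Delta> ctx \<Longrightarrow> ctx_renaming r \<Gamma> \<Delta> \<Longrightarrow> P \<Delta> r"
  by (simp add: renaming_stable_def)

lemma ren_upr_wk: "ren (upr r) (wk 1 t) = wk 1 (ren r t)" "ren (upr (upr r)) (wk 2 t) = wk 2 (ren r t)"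
  by simp_all

text \<open>The rules contain variables bound by an eliminator, which renamings under binders fix.\<close>
lemma upr_id: "upr (upr r) 1 = 1" "upr (upr (upr r)) 2 = 2" "upr (upr (upr r)) 1 = 1"
  by simp_all

lemmas ren_pushes = ren.simps(2-25) ren_defs ren_Homotopy ren_happly ren_insts ren_upr_wk

lemmas syntax_rules =
  univ pi_form pi_intro pi_elim pi_beta pi_eta pi_form_eq pi_intro_eq pi_elim_eq
  sig_form sig_intro sig_elim sig_beta sig_form_eq sig_intro_eq sig_elim_eq
  sum_form sum_intro1 sum_intro2 sum_elim sum_beta1 sum_beta2
  sum_form_eq sum_intro1_eq sum_intro2_eq sum_elim_eq
  empty_form empty_elim empty_elim_eq
  unit_form unit_intro unit_elim unit_beta unit_elim_eq
  nat_form nat_intro1 nat_intro2 nat_elim nat_beta1 nat_beta2 nat_intro2_eq nat_elim_eq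
  id_form id_intro id_elim id_beta id_form_eq id_intro_eq id_elim_eq
  funext funext_eq

lemmas structural_rules = eq_refl eq_sym eq_trans conv eq_conv cumul eq_cumul

text \<open>Every rule is an instance of the same argument: after peeling the binders, the renamed premises
  are the premises of the same rule.\<close>
lemma renaming:
  "\<turnstile> \<Gamma> ctx \<Longrightarrow> renaming_stable \<Gamma> (\<lambda>\<Delta> r. True)"
  "\<Gamma> \<turnstile> a \<Ztypecolon> A \<Longrightarrow> renaming_stable \<Gamma> (\<lambda>\<Delta> r. \<Delta> \<turnstile> ren r a \<Ztypecolon> ren r A)"
  "\<Gamma> \<turnstile> a \<doteq> b \<Ztypecolon> A \<Longrightarrow> renaming_stable \<Gamma> (\<lambda>\<Delta> r. \<Delta> \<turnstile> ren r a \<doteq> ren r b \<Ztypecolon> ren r A)"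
proof (induction rule: wfctx_typing_eqtm.inducts)
  case ctx_nil then show ?case by (simp add: renaming_stable_def)
next
  case ctx_cons then show ?case by (auto simp add: renaming_stable_def)
next
  case (var \<Gamma> n)
  then show ?case
    by (auto simp: renaming_stable_def ctx_renaming_def intro: wfctx_typing_eqtm.var)
qed (((drule stable_peel)+)?, rule stableI, erule stable_entries, (drule (2) stableD)+,
     (simp only: ren_pushes ren.simps(1) upr_id upr_simps(1))?,
     (rule structural_rules syntax_rules; assumption+))+

text \<open>All tails are included for the rules whose only premises lie over an extended context.\<close>
lemma contexts_wf:
  "\<turnstile> \<Gamma> ctx \<Longrightarrow> \<forall>n. \<turnstile> drop n \<Gamma> ctx"
  "\<Gamma> \<turnstile> a \<Ztypecolon> A \<Longrightarrow> \<forall>n. \<turnstile> drop n \<Gamma> ctx"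
  "\<Gamma> \<turnstile> a \<doteq> b \<Ztypecolon> A \<Longrightarrow> \<forall>n. \<turnstile> drop n \<Gamma> ctx"
proof (induction rule: wfctx_typing_eqtm.inducts)
  case ctx_nil then show ?case by (simp add: wfctx_typing_eqtm.ctx_nil)
next
  case (ctx_cons \<Gamma> A i)
  then show ?case by (auto simp: drop_Cons split: nat.split intro: wfctx_typing_eqtm.ctx_cons)
qed (assumption | metis drop_Suc_Cons)+

lemma typing_ctx: "\<Gamma> \<turnstile> a \<Ztypecolon> A \<Longrightarrow> \<turnstile> \<Gamma> ctx"
  using contexts_wf(2)[of \<Gamma> a A] by (metis drop0)

lemma weaken:
  assumes "\<Gamma> \<turnstile> a \<Ztypecolon> A" "\<Gamma> \<turnstile> B \<Ztypecolon> Univ i"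
  shows "B # \<Gamma> \<turnstile> \<up>a \<Ztypecolon> \<up>A"
  using stableD[OF renaming(2)[OF assms(1)] ctx_cons[OF assms(2)] ctx_renaming_Suc] .

lemma weaken_under:
  assumes "C # \<Gamma> \<turnstile> a \<Ztypecolon> A" "\<Gamma> \<turnstile> B \<Ztypecolon> Univ i"
  shows "\<up>C # B # \<Gamma> \<turnstile> ren (upr Suc) a \<Ztypecolon> ren (upr Suc) A"
  using stableD[OF stable_peel[OF renaming(2)[OF assms(1)]] ctx_cons[OF assms(2)] ctx_renaming_Suc] .

lemmas weaken_type = weaken[where A = "Univ j" for j, simplified]
lemmas weaken_under_type = weaken_under[where A = "Univ j" for j, simplified]

lemma var0: "\<Gamma> \<turnstile> A \<Ztypecolon> Univ i \<Longrightarrow> A # \<Gamma> \<turnstile> Var 0 \<Ztypecolon> \<up>A"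
  using var[OF ctx_cons, of \<Gamma> A i 0] by simp

lemma cumul_le: "\<Gamma> \<turnstile> A \<Ztypecolon> Univ i \<Longrightarrow> i \<le> j \<Longrightarrow> \<Gamma> \<turnstile> A \<Ztypecolon> Univ j"
  by (induction j rule: nat_induct) (auto simp: le_Suc_eq intro: cumul)

section \<open>Natural deduction for inhabited types\<close>

definition inhabited :: "tm list \<Rightarrow> tm \<Rightarrow> bool" ("_ \<TTurnstile> _" [51, 51] 50) where
  "\<Gamma> \<TTurnstile> A \<longleftrightarrow> (\<exists>t. \<Gamma> \<turnstile> t \<Ztypecolon> A)"

lemma inhI: "\<Gamma> \<turnstile> t \<Ztypecolon> A \<Longrightarrow> \<Gamma> \<TTurnstile> A"
  by (auto simp: inhabited_def)

lemma inh_weaken: "\<Gamma> \<TTurnstile> A \<Longrightarrow> \<Gamma> \<turnstile> B \<Ztypecolon> Univ i \<Longrightarrow> B # \<Gamma> \<TTurnstile> \<up>A"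
  by (auto simp: inhabited_def intro: weaken)

lemma inh_weaken_under: "C # \<Gamma> \<TTurnstile> A \<Longrightarrow> \<Gamma> \<turnstile> B \<Ztypecolon> Univ i \<Longrightarrow> \<up>C # B # \<Gamma> \<TTurnstile> ren (upr Suc) A"
  by (auto simp: inhabited_def intro: weaken_under)

lemma inh_var0: "\<Gamma> \<turnstile> A \<Ztypecolon> Univ i \<Longrightarrow> A # \<Gamma> \<TTurnstile> \<up>A"
  by (rule inhI[OF var0])

lemma inh_pi_I: "A # \<Gamma> \<TTurnstile> B \<Longrightarrow> \<Gamma> \<TTurnstile> TPi A B"
  by (auto simp: inhabited_def intro: pi_intro)

lemma inh_pi_E: "\<Gamma> \<TTurnstile> TPi A B \<Longrightarrow> \<Gamma> \<turnstile> a \<Ztypecolon> A \<Longrightarrow> \<Gamma> \<TTurnstile> B[[a]]"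
  by (auto simp: inhabited_def intro: pi_elim)

lemma inh_arr_I: "A # \<Gamma> \<TTurnstile> \<up>B \<Longrightarrow> \<Gamma> \<TTurnstile> Arr A B"
  by (simp add: Arr_def inh_pi_I)

lemma inh_arr_E: "\<Gamma> \<TTurnstile> Arr A B \<Longrightarrow> \<Gamma> \<TTurnstile> A \<Longrightarrow> \<Gamma> \<TTurnstile> B"
  unfolding Arr_def inhabited_def[of \<Gamma> A] by (auto dest: inh_pi_E)

lemma inst_var0_under [simp]: "(ren (upr Suc) B)[[Var 0]] = B"
proof -
  have "(\<lambda>n. (Var 0 \<bullet> Var) (upr Suc n)) = Var"
  proof
    show "(Var 0 \<bullet> Var) (upr Suc n) = Var n" for n by (cases n) simp_all
  qed
  then show ?thesis by (simp add: sub_ren)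
qed

lemma app_typ: "\<Gamma> \<turnstile> f \<Ztypecolon> Arr A B \<Longrightarrow> \<Gamma> \<turnstile> a \<Ztypecolon> A \<Longrightarrow> \<Gamma> \<turnstile> App f a \<Ztypecolon> B"
  unfolding Arr_def using pi_elim[of \<Gamma> f A "\<up>B" a] by simp

lemma app_var0: "\<Gamma> \<turnstile> A \<Ztypecolon> Univ i \<Longrightarrow> \<Gamma> \<turnstile> f \<Ztypecolon> TPi A B \<Longrightarrow> A # \<Gamma> \<turnstile> App \<up>f (Var 0) \<Ztypecolon> B"
  using pi_elim[OF weaken[of \<Gamma> f "TPi A B" A i, simplified] var0] by simp

section \<open>Formation of the defined types\<close>

lemma Arr_form: "\<Gamma> \<turnstile> A \<Ztypecolon> Univ i \<Longrightarrow> \<Gamma> \<turnstile> B \<Ztypecolon> Univ i \<Longrightarrow> \<Gamma> \<turnstile> Arr A B \<Ztypecolon> Univ i"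
  unfolding Arr_def by (auto intro!: pi_form weaken_type)

lemma Prod_form: "\<Gamma> \<turnstile> A \<Ztypecolon> Univ i \<Longrightarrow> \<Gamma> \<turnstile> B \<Ztypecolon> Univ i \<Longrightarrow> \<Gamma> \<turnstile> Prod A B \<Ztypecolon> Univ i"
  unfolding Prod_def by (auto intro!: sig_form weaken_type)

lemma Neg_form: "\<Gamma> \<turnstile> A \<Ztypecolon> Univ i \<Longrightarrow> \<Gamma> \<turnstile> Neg A \<Ztypecolon> Univ i"
  unfolding Neg_def by (auto intro!: Arr_form empty_form typing_ctx)

lemma isProp_form:
  assumes "\<Gamma> \<turnstile> A \<Ztypecolon> Univ i" shows "\<Gamma> \<turnstile> isProp A \<Ztypecolon> Univ i"
proof -
  have A: "A # \<Gamma> \<turnstile> \<up>A \<Ztypecolon> Univ i" by (rule weaken_type[OF assms assms])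
  have "\<up>A # A # \<Gamma> \<turnstile> Var 1 \<Ztypecolon> \<up>\<up>A"
    using weaken[OF var0[OF assms] A] by simp
  then show ?thesis
    unfolding isProp_def using assms A
    by (auto intro!: pi_form id_form weaken_type var0)
qed

lemma Fib_form:
  assumes "\<Gamma> \<turnstile> X \<Ztypecolon> Univ k" "\<Gamma> \<turnstile> Y \<Ztypecolon> Univ k" "\<Gamma> \<turnstile> f \<Ztypecolon> Arr X Y" "\<Gamma> \<turnstile> y \<Ztypecolon> Y"
  shows "\<Gamma> \<turnstile> Fib X Y f y \<Ztypecolon> Univ k"
    and "X # \<Gamma> \<turnstile> TId \<up>Y (App \<up>f (Var 0)) \<up>y \<Ztypecolon> Univ k"
proof -
  show *: "X # \<Gamma> \<turnstile> TId \<up>Y (App \<up>f (Var 0)) \<up>y \<Ztypecolon> Univ k"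
    using weaken[OF assms(3) assms(1)] weaken[OF assms(4) assms(1)] assms
    by (auto intro!: id_form weaken_type app_typ[where A = "\<up>X"] var0)
  show "\<Gamma> \<turnstile> Fib X Y f y \<Ztypecolon> Univ k"
    unfolding Fib_def using sig_form[OF assms(1) *] by simp
qed

lemma isEmb_form:
  assumes "\<Gamma> \<turnstile> X \<Ztypecolon> Univ k" "\<Gamma> \<turnstile> Y \<Ztypecolon> Univ k" "\<Gamma> \<turnstile> f \<Ztypecolon> Arr X Y"
  shows "\<Gamma> \<turnstile> isEmb X Y f \<Ztypecolon> Univ k"
  unfolding isEmb_def using weaken[OF assms(3) assms(2)] assms
  by (auto intro!: pi_form isProp_form Fib_form weaken_type var0)

lemma Emb_form:
  assumes "\<Gamma> \<turnstile> X \<Ztypecolon> Univ k" "\<Gamma> \<turnstile> Y \<Ztypecolon> Univ k"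
  shows "\<Gamma> \<turnstile> Emb X Y \<Ztypecolon> Univ k" and "Arr X Y # \<Gamma> \<turnstile> isEmb \<up>X \<up>Y (Var 0) \<Ztypecolon> Univ k"
proof -
  show *: "Arr X Y # \<Gamma> \<turnstile> isEmb \<up>X \<up>Y (Var 0) \<Ztypecolon> Univ k"
    using assms var0[of \<Gamma> "Arr X Y" k] by (auto intro!: isEmb_form weaken_type Arr_form)
  show "\<Gamma> \<turnstile> Emb X Y \<Ztypecolon> Univ k"
    unfolding Emb_def using sig_form[OF Arr_form[OF assms] *] by simp
qed

lemma inverse_laws_form:
  assumes "\<Gamma> \<turnstile> A \<Ztypecolon> Univ k" "\<Gamma> \<turnstile> B \<Ztypecolon> Univ k" "\<Gamma> \<turnstile> f \<Ztypecolon> Arr A B"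
  shows "Arr B A # \<Gamma> \<turnstile> TPi \<up>B (TId \<up>\<up>B (App \<up>\<up>f (App (Var 1) (Var 0))) (Var 0)) \<Ztypecolon> Univ k" (is ?r)
    and "Arr B A # \<Gamma> \<turnstile> TPi \<up>A (TId \<up>\<up>A (App (Var 1) (App \<up>\<up>f (Var 0))) (Var 0)) \<Ztypecolon> Univ k" (is ?l)
proof -
  note BA = Arr_form[OF assms(2,1)]
  note A = weaken_type[OF assms(1) BA] and B = weaken_type[OF assms(2) BA]
  note f = weaken[OF assms(3) BA, simplified]
  note g = var0[OF BA, simplified]
  show ?r
    using app_typ[OF weaken[OF f B, simplified]] app_typ[OF weaken[OF g B, simplified]]
    by (auto intro!: pi_form id_form B weaken_type[OF B B] var0)
  show ?l
    using app_typ[OF weaken[OF f A, simplified]] app_typ[OF weaken[OF g A, simplified]]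
    by (auto intro!: pi_form id_form A weaken_type[OF A A] var0)
qed

lemma isEquiv_form:
  assumes "\<Gamma> \<turnstile> A \<Ztypecolon> Univ k" "\<Gamma> \<turnstile> B \<Ztypecolon> Univ k" "\<Gamma> \<turnstile> f \<Ztypecolon> Arr A B"
  shows "\<Gamma> \<turnstile> isEquiv A B f \<Ztypecolon> Univ k"
  unfolding isEquiv_def using inverse_laws_form[OF assms] assms
  by (auto intro!: Prod_form sig_form Arr_form)

lemma Equiv_form:
  assumes "\<Gamma> \<turnstile> A \<Ztypecolon> Univ k" "\<Gamma> \<turnstile> B \<Ztypecolon> Univ k"
  shows "Arr A B # \<Gamma> \<turnstile> isEquiv \<up>A \<up>B (Var 0) \<Ztypecolon> Univ k"
  using assms var0[of \<Gamma> "Arr A B" k] by (auto intro!: isEquiv_form weaken_type Arr_form)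

lemma LEM_form:
  assumes "\<turnstile> \<Gamma> ctx" shows "\<Gamma> \<turnstile> LEM k \<Ztypecolon> Univ (Suc k)"
proof -
  have U: "\<Gamma> \<turnstile> Univ k \<Ztypecolon> Univ (Suc k)" by (rule univ[OF assms])
  have P: "Univ k # \<Gamma> \<turnstile> Var 0 \<Ztypecolon> Univ k" using var0[OF U] by simp
  show ?thesis unfolding LEM_def
    by (rule pi_form[OF U]) (auto intro!: cumul[of _ _ k] Arr_form isProp_form sum_form Neg_form P)
qed

section \<open>Dependent pairs\<close>

lemma sub_ups_scons_under [simp]: "sub (ups (a \<bullet> s)) (ren (upr Suc) t) = sub (ups s) t"
  unfolding sub_ren by (rule sub_cong) (simp add: upr_def split: nat.split)

lemma sub_ups_shift2: "sub (ups (shift 2)) t = ren (upr Suc) (ren (upr Suc) t)"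
  unfolding ren_ren by (subst ren_as_sub) (rule sub_cong, simp add: ups_def scons_def upr_def shift_def wk_def split: nat.split)

text \<open>The first projection, with the constant family \<open>A\<close> as motive.\<close>
definition fst_tm where "fst_tm A p = IndSig \<up>A (Var 1) p"

lemma fst_tm_ren [simp]: "ren r (fst_tm A p) = fst_tm (ren r A) (ren r p)"
  by (simp add: fst_tm_def)
lemma fst_tm_sub [simp]: "sub r (fst_tm A p) = fst_tm (sub r A) (sub r p)"
  by (simp add: fst_tm_def)

lemma
  assumes "\<Gamma> \<turnstile> A \<Ztypecolon> Univ i" "A # \<Gamma> \<turnstile> B \<Ztypecolon> Univ i"
  shows fst_typ: "\<Gamma> \<turnstile> p \<Ztypecolon> TSig A B \<Longrightarrow> \<Gamma> \<turnstile> fst_tm A p \<Ztypecolon> A"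
    and fst_beta: "\<Gamma> \<turnstile> a \<Ztypecolon> A \<Longrightarrow> \<Gamma> \<turnstile> b \<Ztypecolon> B[[a]] \<Longrightarrow> \<Gamma> \<turnstile> fst_tm A (MkPair a b) \<doteq> a \<Ztypecolon> A"
proof -
  note C = weaken_type[OF assms(1) sig_form[OF assms]]
  have g: "B # A # \<Gamma> \<turnstile> Var 1 \<Ztypecolon> sub (MkPair (Var 1) (Var 0) \<bullet> shift 2) \<up>A"
    using weaken[OF var0[OF assms(1)] assms(2)] by simp
  show "\<Gamma> \<turnstile> p \<Ztypecolon> TSig A B \<Longrightarrow> \<Gamma> \<turnstile> fst_tm A p \<Ztypecolon> A"
    using sig_elim[OF C g] by (simp add: fst_tm_def)
  show "\<Gamma> \<turnstile> a \<Ztypecolon> A \<Longrightarrow> \<Gamma> \<turnstile> b \<Ztypecolon> B[[a]] \<Longrightarrow> \<Gamma> \<turnstile> fst_tm A (MkPair a b) \<doteq> a \<Ztypecolon> A"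
    using sig_beta[OF C g] by (simp add: fst_tm_def)
qed

text \<open>The motive for the second projection is \<open>B\<close> at the first projection of the pair. It is written as
  a beta-redex, because then it is a type by \<open>pi_elim\<close>; conversion removes the redex both in the
  case of a literal pair, by \<open>fst_beta\<close>, and in the result.\<close>
lemma snd_inh:
  assumes A: "\<Gamma> \<turnstile> A \<Ztypecolon> Univ i" and B: "A # \<Gamma> \<turnstile> B \<Ztypecolon> Univ i" and p: "\<Gamma> \<turnstile> p \<Ztypecolon> TSig A B"
  shows "\<Gamma> \<TTurnstile> B[[fst_tm A p]]"
proof -
  let ?M = "App (Lam \<up>A (ren (upr Suc) B)) (fst_tm \<up>A (Var 0))"
  let ?B2 = "ren (upr Suc) (ren (upr Suc) B)"
  note S = sig_form[OF A B]
  have M: "TSig A B # \<Gamma> \<turnstile> ?M \<Ztypecolon> Univ i"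
    using pi_elim[OF pi_intro[OF weaken_under_type[OF B S]] fst_typ[OF weaken_type[OF A S] weaken_under_type[OF B S]]]
      var0[OF S] by simp
  note A2 = weaken_type[OF weaken_type[OF A A] B]
  note B2 = weaken_under_type[OF weaken_under_type[OF B A] B]
  have v1: "B # A # \<Gamma> \<turnstile> Var 1 \<Ztypecolon> \<up>\<up>A"
    using weaken[OF var0[OF A] B] by simp
  have B2v: "?B2[[Var 1]] = \<up>B"
    unfolding sub_ren ren_as_sub[of Suc] by (rule sub_cong) (simp add: upr_def split: nat.split)
  have v0: "B # A # \<Gamma> \<turnstile> Var 0 \<Ztypecolon> ?B2[[Var 1]]"
    unfolding B2v by (rule var0[OF B])
  have L: "B # A # \<Gamma> \<turnstile> Lam \<up>\<up>A ?B2 \<Ztypecolon> TPi \<up>\<up>A (Univ i)"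
    by (rule pi_intro[OF B2])
  have "B # A # \<Gamma> \<turnstile> App (Lam \<up>\<up>A ?B2) (fst_tm \<up>\<up>A (MkPair (Var 1) (Var 0))) \<doteq>
      App (Lam \<up>\<up>A ?B2) (Var 1) \<Ztypecolon> Univ i"
    using pi_elim_eq[OF eq_refl[OF L] fst_beta[OF A2 B2 v1 v0]] by simp
  moreover have "B # A # \<Gamma> \<turnstile> App (Lam \<up>\<up>A ?B2) (Var 1) \<doteq> \<up>B \<Ztypecolon> Univ i"
    using pi_beta[OF B2 v1] B2v by simp
  ultimately have "B # A # \<Gamma> \<turnstile> Var 0 \<Ztypecolon> App (Lam \<up>\<up>A ?B2) (fst_tm \<up>\<up>A (MkPair (Var 1) (Var 0)))"
    using var0[OF B] by (blast intro: conv eq_sym eq_trans)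
  then have g: "B # A # \<Gamma> \<turnstile> Var 0 \<Ztypecolon> sub (MkPair (Var 1) (Var 0) \<bullet> shift 2) ?M"
    using sub_ups_shift2[of B] by simp
  have "\<Gamma> \<turnstile> IndSig ?M (Var 0) p \<Ztypecolon> App (Lam A B) (fst_tm A p)"
    using sig_elim[OF M g p] by simp
  moreover have "\<Gamma> \<turnstile> App (Lam A B) (fst_tm A p) \<doteq> B[[fst_tm A p]] \<Ztypecolon> Univ i"
    using pi_beta[OF B fst_typ[OF A B p]] by simp
  ultimately show ?thesis by (blast intro: inhI conv)
qed

lemma inh_sig_E:
  assumes "\<Gamma> \<TTurnstile> TSig A B" "\<Gamma> \<turnstile> A \<Ztypecolon> Univ i" "A # \<Gamma> \<turnstile> B \<Ztypecolon> Univ i"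
  obtains a where "\<Gamma> \<turnstile> a \<Ztypecolon> A" "\<Gamma> \<TTurnstile> B[[a]]"
  using assms fst_typ snd_inh unfolding inhabited_def[of \<Gamma> "TSig A B"] by blast

lemma inh_sig_I:
  "A # \<Gamma> \<turnstile> B \<Ztypecolon> Univ i \<Longrightarrow> \<Gamma> \<turnstile> a \<Ztypecolon> A \<Longrightarrow> \<Gamma> \<TTurnstile> B[[a]] \<Longrightarrow> \<Gamma> \<TTurnstile> TSig A B"
  by (auto simp: inhabited_def intro: sig_intro)

lemma inh_prod_E:
  assumes "\<Gamma> \<TTurnstile> Prod A B" "\<Gamma> \<turnstile> A \<Ztypecolon> Univ i" "\<Gamma> \<turnstile> B \<Ztypecolon> Univ i"
  shows "\<Gamma> \<TTurnstile> A" "\<Gamma> \<TTurnstile> B"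
proof -
  have "\<Gamma> \<TTurnstile> TSig A \<up>B" "A # \<Gamma> \<turnstile> \<up>B \<Ztypecolon> Univ i"
    using assms by (simp_all add: Prod_def weaken_type)
  then show "\<Gamma> \<TTurnstile> A" "\<Gamma> \<TTurnstile> B"
    using assms(2) by (auto elim!: inh_sig_E intro: inhI)
qed

lemma inh_prod_I:
  assumes "\<Gamma> \<turnstile> A \<Ztypecolon> Univ i" "\<Gamma> \<turnstile> B \<Ztypecolon> Univ i" "\<Gamma> \<TTurnstile> A" "\<Gamma> \<TTurnstile> B"
  shows "\<Gamma> \<TTurnstile> Prod A B"
  using assms weaken_type[OF assms(2,1)] unfolding Prod_def inhabited_def[of \<Gamma> A]
  by (auto intro!: inh_sig_I)

section \<open>Sums, negation and natural numbers\<close>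

lemma inh_sum_E:
  assumes "\<Gamma> \<TTurnstile> TSum A B" "\<Gamma> \<turnstile> A \<Ztypecolon> Univ i" "\<Gamma> \<turnstile> B \<Ztypecolon> Univ i" "\<Gamma> \<turnstile> C \<Ztypecolon> Univ j"
    "A # \<Gamma> \<TTurnstile> \<up>C" "B # \<Gamma> \<TTurnstile> \<up>C"
  shows "\<Gamma> \<TTurnstile> C"
proof -
  obtain e c d where e: "\<Gamma> \<turnstile> e \<Ztypecolon> TSum A B" and c: "A # \<Gamma> \<turnstile> c \<Ztypecolon> \<up>C" and d: "B # \<Gamma> \<turnstile> d \<Ztypecolon> \<up>C"
    using assms by (auto simp: inhabited_def)
  show ?thesis
    using sum_elim[OF weaken_type[OF assms(4) sum_form[OF assms(2,3)]] _ _ e, of c d] c d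
    by (auto intro: inhI)
qed

lemma inh_sum_I1: "\<Gamma> \<turnstile> A \<Ztypecolon> Univ i \<Longrightarrow> \<Gamma> \<turnstile> B \<Ztypecolon> Univ i \<Longrightarrow> \<Gamma> \<TTurnstile> A \<Longrightarrow> \<Gamma> \<TTurnstile> TSum A B"
  and inh_sum_I2: "\<Gamma> \<turnstile> A \<Ztypecolon> Univ i \<Longrightarrow> \<Gamma> \<turnstile> B \<Ztypecolon> Univ i \<Longrightarrow> \<Gamma> \<TTurnstile> B \<Longrightarrow> \<Gamma> \<TTurnstile> TSum A B"
  by (auto simp: inhabited_def intro: sum_intro1 sum_intro2)

lemma inh_empty_E: "\<Gamma> \<TTurnstile> TEmpty \<Longrightarrow> \<Gamma> \<turnstile> C \<Ztypecolon> Univ i \<Longrightarrow> \<Gamma> \<TTurnstile> C"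
  using empty_elim[OF weaken_type[OF _ empty_form[OF typing_ctx]], of \<Gamma> C i C]
  by (auto simp: inhabited_def)

lemma inh_neg_E: "\<Gamma> \<TTurnstile> Neg A \<Longrightarrow> \<Gamma> \<TTurnstile> A \<Longrightarrow> \<Gamma> \<turnstile> C \<Ztypecolon> Univ i \<Longrightarrow> \<Gamma> \<TTurnstile> C"
  unfolding Neg_def by (rule inh_empty_E[OF inh_arr_E])

text \<open>Induction without the induction hypothesis.\<close>
lemma inh_nat_cases:
  assumes C: "TNat # \<Gamma> \<turnstile> C \<Ztypecolon> Univ i" and "\<Gamma> \<TTurnstile> C[[Ze]]"
    and "TNat # \<Gamma> \<TTurnstile> sub (Su (Var 0) \<bullet> shift 1) C" and "\<Gamma> \<turnstile> n \<Ztypecolon> TNat"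
  shows "\<Gamma> \<TTurnstile> C[[n]]"
proof -
  obtain c d where c: "\<Gamma> \<turnstile> c \<Ztypecolon> C[[Ze]]" and d: "TNat # \<Gamma> \<turnstile> d \<Ztypecolon> sub (Su (Var 0) \<bullet> shift 1) C"
    using assms by (auto simp: inhabited_def)
  have "\<up>(sub (Su (Var 0) \<bullet> shift 1) C) = sub (Su (Var 1) \<bullet> shift 2) C"
    unfolding ren_sub by (rule sub_cong) (simp add: scons_def shift_def numeral_eq_Suc split: nat.split)
  then show ?thesis
    using nat_elim[OF C c _ assms(4)] weaken[OF d C] by (auto intro: inhI)
qed

section \<open>Rules over arbitrary weakenings\<close>

text \<open>A rule that introduces a hypothesis quantifies over all such renamings of the context, in place
  of naming the extended context. In repeated uses the hypotheses then stay behind \<open>ren \<rho>\<close>, and no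
  de Bruijn indices of hypotheses appear.\<close>
definition weakens :: "(nat \<Rightarrow> nat) \<Rightarrow> tm list \<Rightarrow> tm list \<Rightarrow> bool" where
  "weakens \<rho> \<Gamma> \<Delta> \<longleftrightarrow> (\<forall>a A. \<Gamma> \<turnstile> a \<Ztypecolon> A \<longrightarrow> \<Delta> \<turnstile> ren \<rho> a \<Ztypecolon> ren \<rho> A)"

lemma weakens_typ: "weakens \<rho> \<Gamma> \<Delta> \<Longrightarrow> \<Gamma> \<turnstile> a \<Ztypecolon> A \<Longrightarrow> \<Delta> \<turnstile> ren \<rho> a \<Ztypecolon> ren \<rho> A"
  by (simp add: weakens_def)

lemma weakens_type: "weakens \<rho> \<Gamma> \<Delta> \<Longrightarrow> \<Gamma> \<turnstile> A \<Ztypecolon> Univ i \<Longrightarrow> \<Delta> \<turnstile> ren \<rho> A \<Ztypecolon> Univ i"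
  using weakens_typ[of \<rho> \<Gamma> \<Delta> A "Univ i"] by simp

lemma weakens_inh: "weakens \<rho> \<Gamma> \<Delta> \<Longrightarrow> \<Gamma> \<TTurnstile> A \<Longrightarrow> \<Delta> \<TTurnstile> ren \<rho> A"
  by (auto simp: inhabited_def dest: weakens_typ)

lemma weakens_Suc: "\<Gamma> \<turnstile> A \<Ztypecolon> Univ i \<Longrightarrow> weakens Suc \<Gamma> (A # \<Gamma>)"
  by (simp add: weakens_def weaken)

lemma weakens_trans: "weakens \<rho> \<Gamma> \<Delta> \<Longrightarrow> weakens \<rho>' \<Delta> \<Theta> \<Longrightarrow> weakens (\<lambda>n. \<rho>' (\<rho> n)) \<Gamma> \<Theta>"
  by (metis weakens_def ren_ren)

lemma weakening_arr_I:
  assumes "\<Gamma> \<turnstile> A \<Ztypecolon> Univ i"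
    and "\<And>\<Delta> \<rho>. weakens \<rho> \<Gamma> \<Delta> \<Longrightarrow> \<Delta> \<TTurnstile> ren \<rho> A \<Longrightarrow> \<Delta> \<TTurnstile> ren \<rho> B"
  shows "\<Gamma> \<TTurnstile> Arr A B"
  by (rule inh_arr_I[OF assms(2)[OF weakens_Suc[OF assms(1)] inh_var0[OF assms(1)]]])

lemma weakening_neg_I:
  assumes "\<Gamma> \<turnstile> A \<Ztypecolon> Univ i"
    and "\<And>\<Delta> \<rho>. weakens \<rho> \<Gamma> \<Delta> \<Longrightarrow> \<Delta> \<TTurnstile> ren \<rho> A \<Longrightarrow> \<Delta> \<TTurnstile> TEmpty"
  shows "\<Gamma> \<TTurnstile> Neg A"
  unfolding Neg_def using assms by (auto intro: weakening_arr_I)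

lemma weakening_sum_E:
  assumes AB: "\<Gamma> \<TTurnstile> TSum A B" and A: "\<Gamma> \<turnstile> A \<Ztypecolon> Univ i" and B: "\<Gamma> \<turnstile> B \<Ztypecolon> Univ i" and C: "\<Gamma> \<turnstile> C \<Ztypecolon> Univ j"
    and "\<And>\<Delta> \<rho>. weakens \<rho> \<Gamma> \<Delta> \<Longrightarrow> \<Delta> \<TTurnstile> ren \<rho> A \<Longrightarrow> \<Delta> \<TTurnstile> ren \<rho> C"
    and "\<And>\<Delta> \<rho>. weakens \<rho> \<Gamma> \<Delta> \<Longrightarrow> \<Delta> \<TTurnstile> ren \<rho> B \<Longrightarrow> \<Delta> \<TTurnstile> ren \<rho> C"
  shows "\<Gamma> \<TTurnstile> C"
  by (rule inh_sum_E[OF AB A B C assms(5)[OF weakens_Suc[OF A] inh_var0[OF A]]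
        assms(6)[OF weakens_Suc[OF B] inh_var0[OF B]]])

section \<open>Identity types\<close>

lemma sub_scons_scons_under [simp]: "sub (a \<bullet> b \<bullet> s) (ren (upr Suc) t) = sub (a \<bullet> s) t"
  unfolding sub_ren by (rule sub_cong) (simp add: upr_def split: nat.split)

lemma sub_var0_shift1 [simp]: "sub (Var 0 \<bullet> shift (Suc 0)) t = t"
proof -
  have "sub (Var 0 \<bullet> shift (Suc 0)) t = sub Var t"
    by (rule sub_cong) (simp add: scons_def shift_def split: nat.split)
  then show ?thesis by simp
qed

lemma sub_ups_shift1: "sub (ups (shift (Suc 0))) t = ren (upr Suc) t"
  by (subst ren_as_sub) (rule sub_cong, simp add: ups_def scons_def upr_def shift_def wk_def split: nat.split)

text \<open>Path induction with the motive \<open>C x \<rightarrow> C y\<close>.\<close>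
lemma transport:
  assumes A: "\<Gamma> \<turnstile> A \<Ztypecolon> Univ i" and C: "A # \<Gamma> \<turnstile> C \<Ztypecolon> Univ j"
    and a: "\<Gamma> \<turnstile> a \<Ztypecolon> A" and b: "\<Gamma> \<turnstile> b \<Ztypecolon> A"
    and "\<Gamma> \<TTurnstile> TId A a b" "\<Gamma> \<TTurnstile> C[[a]]"
  shows "\<Gamma> \<TTurnstile> C[[b]]"
proof -
  \<comment> \<open>In the context \<open>x, y : A, q : x = y\<close>, the first copy of \<open>C\<close> speaks of \<open>x\<close> and skips \<open>y\<close> and
    \<open>q\<close>; the second speaks of \<open>y\<close>, its own variable, and skips \<open>x\<close> below and \<open>q\<close> above it.\<close>
  let ?M = "Arr \<up>\<up>C \<up>(ren (upr Suc) C)"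
  obtain p where p: "\<Gamma> \<turnstile> p \<Ztypecolon> TId A a b" using assms by (auto simp: inhabited_def)
  note A1 = weaken_type[OF A A]
  have v1: "\<up>A # A # \<Gamma> \<turnstile> Var 1 \<Ztypecolon> \<up>\<up>A" using weaken[OF var0[OF A] A1] by simp
  have I: "\<up>A # A # \<Gamma> \<turnstile> TId \<up>\<up>A (Var 1) (Var 0) \<Ztypecolon> Univ i"
    by (rule id_form[OF weaken_type[OF A1 A1] v1 var0[OF A1]])
  have M: "TId (wk 2 A) (Var 1) (Var 0) # wk 1 A # A # \<Gamma> \<turnstile> ?M \<Ztypecolon> Univ j"
    using Arr_form[OF weaken_type[OF weaken_type[OF C A1] I] weaken_type[OF weaken_under_type[OF C A] I]]
    by simp
  have c: "A # \<Gamma> \<turnstile> Lam C (Var 0) \<Ztypecolon> sub (Rfl (Var 0) \<bullet> Var 0 \<bullet> Var 0 \<bullet> shift 1) ?M"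
    using pi_intro[OF var0[OF C]] by (simp add: Arr_def)
  have "\<Gamma> \<TTurnstile> Arr (C[[a]]) (C[[b]])"
    using id_elim[OF M c a b p] by (auto intro: inhI)
  then show ?thesis using assms(6) by (rule inh_arr_E)
qed

lemma id_refl: "\<Gamma> \<turnstile> A \<Ztypecolon> Univ i \<Longrightarrow> \<Gamma> \<turnstile> a \<Ztypecolon> A \<Longrightarrow> \<Gamma> \<TTurnstile> TId A a a"
  by (blast intro: inhI id_intro)

lemma id_of_eq:
  assumes "\<Gamma> \<turnstile> a \<doteq> b \<Ztypecolon> A" "\<Gamma> \<turnstile> A \<Ztypecolon> Univ i" "\<Gamma> \<turnstile> a \<Ztypecolon> A"
  shows "\<Gamma> \<TTurnstile> TId A a b"
  by (rule inhI[OF conv[OF id_intro id_form_eq]]) (rule assms eq_refl)+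

lemma id_sym:
  assumes "\<Gamma> \<turnstile> A \<Ztypecolon> Univ i" "\<Gamma> \<turnstile> a \<Ztypecolon> A" "\<Gamma> \<turnstile> b \<Ztypecolon> A" "\<Gamma> \<TTurnstile> TId A a b"
  shows "\<Gamma> \<TTurnstile> TId A b a"
  using transport[OF assms(1) id_form[OF weaken_type[OF assms(1,1)] var0[OF assms(1)] weaken[OF assms(2,1)]]
     assms(2-4)] id_refl[OF assms(1,2)] by simp

lemma id_trans:
  assumes "\<Gamma> \<turnstile> A \<Ztypecolon> Univ i" "\<Gamma> \<turnstile> a \<Ztypecolon> A" "\<Gamma> \<turnstile> b \<Ztypecolon> A" "\<Gamma> \<turnstile> c \<Ztypecolon> A"
    "\<Gamma> \<TTurnstile> TId A a b" "\<Gamma> \<TTurnstile> TId A b c"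
  shows "\<Gamma> \<TTurnstile> TId A a c"
  using transport[OF assms(1) id_form[OF weaken_type[OF assms(1,1)] weaken[OF assms(2,1)] var0[OF assms(1)]]
     assms(3,4,6)] assms(5) by simp

lemma id_ap:
  assumes A: "\<Gamma> \<turnstile> A \<Ztypecolon> Univ i" and B: "\<Gamma> \<turnstile> B \<Ztypecolon> Univ j" and f: "A # \<Gamma> \<turnstile> f \<Ztypecolon> \<up>B"
    and "\<Gamma> \<turnstile> f[[a]] \<Ztypecolon> B" "\<Gamma> \<turnstile> a \<Ztypecolon> A" "\<Gamma> \<turnstile> b \<Ztypecolon> A" "\<Gamma> \<TTurnstile> TId A a b"
  shows "\<Gamma> \<TTurnstile> TId B (f[[a]]) (f[[b]])"
  using transport[OF A id_form[OF weaken_type[OF B A] weaken[OF assms(4) A] f]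
     assms(5,6,7)] id_refl[OF B assms(4)] by simp

lemma id_app:
  assumes A: "\<Gamma> \<turnstile> A \<Ztypecolon> Univ i" and B: "\<Gamma> \<turnstile> B \<Ztypecolon> Univ j" and f: "\<Gamma> \<turnstile> f \<Ztypecolon> Arr A B"
    and "\<Gamma> \<turnstile> a \<Ztypecolon> A" "\<Gamma> \<turnstile> b \<Ztypecolon> A" "\<Gamma> \<TTurnstile> TId A a b"
  shows "\<Gamma> \<TTurnstile> TId B (App f a) (App f b)"
  using id_ap[OF A B app_var0[OF A f[unfolded Arr_def], simplified], of a b] app_typ[OF f assms(4)] assms by simp

text \<open>Equal pairs have equal first components: apply the first projection and compute it on both pairs.\<close>
lemma id_fst:
  assumes A: "\<Gamma> \<turnstile> A \<Ztypecolon> Univ i" and B: "A # \<Gamma> \<turnstile> B \<Ztypecolon> Univ i"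
    and a: "\<Gamma> \<turnstile> a \<Ztypecolon> A" "\<Gamma> \<turnstile> b \<Ztypecolon> B[[a]]" and a': "\<Gamma> \<turnstile> a' \<Ztypecolon> A" "\<Gamma> \<turnstile> b' \<Ztypecolon> B[[a']]"
    and p: "\<Gamma> \<TTurnstile> TId (TSig A B) (MkPair a b) (MkPair a' b')"
  shows "\<Gamma> \<TTurnstile> TId A a a'"
proof -
  note S = sig_form[OF A B]
  note q = sig_intro[OF B a] and q' = sig_intro[OF B a']
  have "TSig A B # \<Gamma> \<turnstile> fst_tm \<up>A (Var 0) \<Ztypecolon> \<up>A"
    using fst_typ[OF weaken_type[OF A S] weaken_under_type[OF B S]] var0[OF S] by simp
  then have "\<Gamma> \<TTurnstile> TId A (fst_tm A (MkPair a b)) (fst_tm A (MkPair a' b'))"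
    using id_ap[OF S A _ _ q q' p, of "fst_tm \<up>A (Var 0)"] fst_typ[OF A B q] by simp
  moreover note id_of_eq[OF fst_beta[OF A B a] A fst_typ[OF A B q]]
    id_of_eq[OF fst_beta[OF A B a'] A fst_typ[OF A B q']]
  ultimately show ?thesis
    using a(1) a'(1) fst_typ[OF A B q] fst_typ[OF A B q'] by (blast intro: id_trans[OF A] id_sym[OF A])
qed

section \<open>Function extensionality and propositions\<close>

lemma Homotopy_form:
  assumes "\<Gamma> \<turnstile> A \<Ztypecolon> Univ i" "A # \<Gamma> \<turnstile> B \<Ztypecolon> Univ i" "\<Gamma> \<turnstile> f \<Ztypecolon> TPi A B" "\<Gamma> \<turnstile> g \<Ztypecolon> TPi A B"
  shows "\<Gamma> \<turnstile> Homotopy A B f g \<Ztypecolon> Univ i"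
  using assms by (auto simp: Homotopy_def intro!: pi_form id_form app_var0)

lemma sub_Homotopy [simp]:
  "sub s (Homotopy A B f g) = Homotopy (sub s A) (sub (ups s) B) (sub s f) (sub s g)"
  by (simp add: Homotopy_def)

text \<open>The type of the function extensionality axiom mentions \<open>happly\<close>; to use the axiom, its type has
  to be formed, hence \<open>happly\<close> typed.\<close>
lemma happly_typ:
  assumes A: "\<Gamma> \<turnstile> A \<Ztypecolon> Univ i" and B: "A # \<Gamma> \<turnstile> B \<Ztypecolon> Univ i"
    and f: "\<Gamma> \<turnstile> f \<Ztypecolon> TPi A B" and g: "\<Gamma> \<turnstile> g \<Ztypecolon> TPi A B"
  shows "\<Gamma> \<turnstile> happly A B f g \<Ztypecolon> Arr (TId (TPi A B) f g) (Homotopy A B f g)"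
proof -
  define I where "I = TId (TPi A B) f g"
  have I: "\<Gamma> \<turnstile> I \<Ztypecolon> Univ i" unfolding I_def by (rule id_form[OF pi_form[OF A B] f g])
  \<comment> \<open>\<open>\<Theta>\<close> is the context below the \<open>Lam\<close> of \<open>happly\<close>, and \<open>A'\<close>, \<open>B'\<close> are \<open>A\<close>, \<open>B\<close> over \<open>\<Theta>\<close>.\<close>
  define \<Theta> where "\<Theta> = I # \<Gamma>"
  define A' B' where "A' = \<up>A" and "B' = ren (upr Suc) B"
  have A': "\<Theta> \<turnstile> A' \<Ztypecolon> Univ i" unfolding \<Theta>_def A'_def by (rule weaken_type[OF A I])
  have B': "A' # \<Theta> \<turnstile> B' \<Ztypecolon> Univ i" unfolding \<Theta>_def A'_def B'_def by (rule weaken_under_type[OF B I])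
  define P where "P = TPi A' B'"
  have P: "\<Theta> \<turnstile> P \<Ztypecolon> Univ i" unfolding P_def by (rule pi_form[OF A' B'])
  have f': "\<Theta> \<turnstile> \<up>f \<Ztypecolon> P" and g': "\<Theta> \<turnstile> \<up>g \<Ztypecolon> P"
    using weaken[OF f I] weaken[OF g I] by (simp_all add: \<Theta>_def P_def A'_def B'_def)
  have p: "\<Theta> \<turnstile> Var 0 \<Ztypecolon> TId P \<up>f \<up>g"
    using var0[OF I] by (simp add: \<Theta>_def P_def A'_def B'_def I_def)
  note P1 = weaken_type[OF P P]
  have v1: "\<up>P # P # \<Theta> \<turnstile> Var 1 \<Ztypecolon> \<up>\<up>P" using weaken[OF var0[OF P] P1] by simp
  have J: "\<up>P # P # \<Theta> \<turnstile> TId \<up>\<up>P (Var 1) (Var 0) \<Ztypecolon> Univ i" (is "_ \<turnstile> ?J \<Ztypecolon> _")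
    by (rule id_form[OF weaken_type[OF P1 P1] v1 var0[OF P1]])
  let ?u = "ren (upr Suc)"
  let ?M = "Homotopy \<up>\<up>\<up>A' (?u (?u (?u B'))) (Var 2) (Var 1)"
  have M: "TId (wk 2 P) (Var 1) (Var 0) # wk 1 P # P # \<Theta> \<turnstile> ?M \<Ztypecolon> Univ i"
    using weaken[OF v1 J] weaken[OF var0[OF P1] J]
    using weaken_type[OF weaken_type[OF weaken_type[OF A' P] P1] J]
      weaken_under_type[OF weaken_under_type[OF weaken_under_type[OF B' P] P1] J]
    by (auto intro!: Homotopy_form simp: P_def numeral_eq_Suc)
  have r: "\<up>A' # P # \<Theta> \<turnstile> App (Var 1) (Var 0) \<Ztypecolon> ren (upr Suc) B'"
    using app_var0[OF weaken_type[OF A' P], of "Var 0" "?u B'"] var0[OF P] by (simp add: P_def)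
  have "sub (ups (Var 0 \<bullet> Var 0 \<bullet> shift (Suc 0))) (?u (?u B')) = ?u B'"
    by (simp add: sub_ups_shift1)
  then have c: "P # \<Theta> \<turnstile> Lam \<up>A' (Rfl (App (Var 1) (Var 0))) \<Ztypecolon>
      sub (Rfl (Var 0) \<bullet> Var 0 \<bullet> Var 0 \<bullet> shift 1) ?M"
    using pi_intro[OF id_intro[OF weaken_under_type[OF B' P] r]] by (simp add: Homotopy_def)
  have "sub (ups (\<up>g \<bullet> \<up>f \<bullet> Var)) (?u (?u B')) = B'"
    unfolding sub_ups_scons_under by simp
  then have "\<Theta> \<turnstile> IndId ?M (Lam \<up>A' (Rfl (App (Var 1) (Var 0)))) \<up>f \<up>g (Var 0) \<Ztypecolon> Homotopy A' B' \<up>f \<up>g"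
    using id_elim[OF M c f' g' p] by simp
  then show ?thesis
    using pi_intro[of I \<Gamma>] by (simp add: happly_def Arr_def wk_4 wkb_4 A'_def B'_def \<Theta>_def I_def)
qed

text \<open>The inverse of \<open>happly\<close> is the first component of the first half of \<open>isEquiv\<close>.\<close>
lemma funext_inh:
  assumes A: "\<Gamma> \<turnstile> A \<Ztypecolon> Univ i" and B: "A # \<Gamma> \<turnstile> B \<Ztypecolon> Univ i"
    and f: "\<Gamma> \<turnstile> f \<Ztypecolon> TPi A B" and g: "\<Gamma> \<turnstile> g \<Ztypecolon> TPi A B"
    and h: "A # \<Gamma> \<TTurnstile> TId B (App \<up>f (Var 0)) (App \<up>g (Var 0))"
  shows "\<Gamma> \<TTurnstile> TId (TPi A B) f g"
proof -
  note I = id_form[OF pi_form[OF A B] f g]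
  note H = Homotopy_form[OF A B f g]
  note laws = inverse_laws_form[OF I H happly_typ[OF A B f g]]
  note E = inhI[OF funext[OF A B f g], unfolded isEquiv_def, simplified]
  have "\<Gamma> \<TTurnstile> Arr (Homotopy A B f g) (TId (TPi A B) f g)"
    using inh_prod_E(1)[OF E sig_form[OF Arr_form[OF H I] laws(1)[simplified]] sig_form[OF Arr_form[OF H I] laws(2)[simplified]]]
    by (rule inh_sig_E[OF _ Arr_form[OF H I] laws(1)[simplified]]) (rule inhI)
  moreover have "\<Gamma> \<TTurnstile> Homotopy A B f g"
    unfolding Homotopy_def using inh_pi_I[OF h] by simp
  ultimately show ?thesis by (rule inh_arr_E)
qed

lemma inh_isProp_I:
  "\<up>P # P # \<Gamma> \<TTurnstile> TId \<up>\<up>P (Var 1) (Var 0) \<Longrightarrow> \<Gamma> \<TTurnstile> isProp P"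
  unfolding isProp_def by (auto intro!: inh_pi_I)

lemma inh_isProp_E:
  assumes "\<Gamma> \<TTurnstile> isProp P" "\<Gamma> \<turnstile> p \<Ztypecolon> P" "\<Gamma> \<turnstile> q \<Ztypecolon> P"
  shows "\<Gamma> \<TTurnstile> TId P p q"
proof -
  have "\<Gamma> \<TTurnstile> TPi P (TId \<up>P \<up>p (Var 0))"
    using inh_pi_E[OF assms(1)[unfolded isProp_def] assms(2)] by simp
  from inh_pi_E[OF this assms(3)] show ?thesis by simp
qed

lemma pi_elements_eq:
  assumes A: "\<Gamma> \<turnstile> A \<Ztypecolon> Univ i" and B: "A # \<Gamma> \<turnstile> B \<Ztypecolon> Univ i" and p: "A # \<Gamma> \<TTurnstile> isProp B"
    and f: "\<Gamma> \<turnstile> f \<Ztypecolon> TPi A B" and g: "\<Gamma> \<turnstile> g \<Ztypecolon> TPi A B"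
  shows "\<Gamma> \<TTurnstile> TId (TPi A B) f g"
  by (rule funext_inh[OF A B f g inh_isProp_E[OF p]]) (rule app_var0[OF A] f g)+

lemma isProp_pi:
  assumes A: "\<Gamma> \<turnstile> A \<Ztypecolon> Univ i" and B: "A # \<Gamma> \<turnstile> B \<Ztypecolon> Univ i" and p: "A # \<Gamma> \<TTurnstile> isProp B"
  shows "\<Gamma> \<TTurnstile> isProp (TPi A B)"
proof (rule inh_isProp_I)
  define P where "P = TPi A B"
  have P: "\<Gamma> \<turnstile> P \<Ztypecolon> Univ i" unfolding P_def by (rule pi_form[OF A B])
  note P1 = weaken_type[OF P P]
  have "\<up>P # P # \<Gamma> \<turnstile> Var 1 \<Ztypecolon> \<up>\<up>P" "\<up>P # P # \<Gamma> \<turnstile> Var 0 \<Ztypecolon> \<up>\<up>P"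
    using weaken[OF var0[OF P] P1] var0[OF P1] by simp_all
  moreover have "\<up>\<up>A # \<up>P # P # \<Gamma> \<TTurnstile> isProp (ren (upr Suc) (ren (upr Suc) B))"
    using inh_weaken_under[OF inh_weaken_under[OF p P] P1] by simp
  ultimately have "\<up>P # P # \<Gamma> \<TTurnstile> TId \<up>\<up>P (Var 1) (Var 0)"
    using pi_elements_eq[OF weaken_type[OF weaken_type[OF A P] P1]
      weaken_under_type[OF weaken_under_type[OF B P] P1]]
    by (simp add: P_def)
  then show "\<up>(TPi A B) # TPi A B # \<Gamma> \<TTurnstile> TId \<up>\<up>(TPi A B) (Var 1) (Var 0)"
    by (simp add: P_def)
qed

text \<open>Both \<open>(x, p)\<close> and \<open>(x', refl)\<close> are points of the fibre of \<open>f\<close> over \<open>f x'\<close>, which is a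
  proposition, so they are equal and have equal first components.\<close>
lemma emb_cancel:
  assumes X: "\<Gamma> \<turnstile> X \<Ztypecolon> Univ k" and Y: "\<Gamma> \<turnstile> Y \<Ztypecolon> Univ k" and f: "\<Gamma> \<turnstile> f \<Ztypecolon> Arr X Y"
    and e: "\<Gamma> \<TTurnstile> isEmb X Y f" and x: "\<Gamma> \<turnstile> x \<Ztypecolon> X" and x': "\<Gamma> \<turnstile> x' \<Ztypecolon> X"
    and p: "\<Gamma> \<TTurnstile> TId Y (App f x) (App f x')"
  shows "\<Gamma> \<TTurnstile> TId X x x'"
proof -
  note fx = app_typ[OF f x']
  let ?B = "TId \<up>Y (App \<up>f (Var 0)) \<up>(App f x')"
  note B = Fib_form(2)[OF X Y f fx]
  obtain t where t: "\<Gamma> \<turnstile> t \<Ztypecolon> TId Y (App f x) (App f x')" using p by (auto simp: inhabited_def)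
  have "\<Gamma> \<turnstile> t \<Ztypecolon> ?B[[x]]" "\<Gamma> \<turnstile> Rfl (App f x') \<Ztypecolon> ?B[[x']]"
    using t id_intro[OF Y fx] by simp_all
  note b = this
  have "\<Gamma> \<TTurnstile> isProp (TSig X ?B)"
    using inh_pi_E[OF e[unfolded isEmb_def] fx] by (simp add: Fib_def)
  from id_fst[OF X B x b(1) x' b(2) inh_isProp_E[OF this sig_intro[OF B x b(1)] sig_intro[OF B x' b(2)]]]
  show ?thesis .
qed

lemma LEM_E:
  assumes "\<Gamma> \<TTurnstile> LEM k" "\<Gamma> \<turnstile> P \<Ztypecolon> Univ k" "\<Gamma> \<TTurnstile> isProp P"
  shows "\<Gamma> \<TTurnstile> TSum P (Neg P)"
  using inh_arr_E[OF inh_pi_E[OF assms(1)[unfolded LEM_def] assms(2), simplified] assms(3)] .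

text \<open>Type-theoretic choice: the choice function maps \<open>x\<close> to the first projection of the given pair.\<close>
lemma choice:
  assumes A: "\<Gamma> \<turnstile> A \<Ztypecolon> Univ i" and B: "\<Gamma> \<turnstile> B \<Ztypecolon> Univ i" and R: "\<up>B # A # \<Gamma> \<turnstile> R \<Ztypecolon> Univ i"
    and F: "A # \<Gamma> \<TTurnstile> TSig \<up>B R"
  obtains h where "\<Gamma> \<turnstile> h \<Ztypecolon> Arr A B" "A # \<Gamma> \<TTurnstile> R[[App \<up>h (Var 0)]]"
proof -
  obtain t where t: "A # \<Gamma> \<turnstile> t \<Ztypecolon> TSig \<up>B R" using F by (auto simp: inhabited_def)
  note B1 = weaken_type[OF B A]
  note s = fst_typ[OF B1 R t]
  let ?h = "Lam A (fst_tm \<up>B t)"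
  have h: "\<Gamma> \<turnstile> ?h \<Ztypecolon> Arr A B" unfolding Arr_def using pi_intro[OF s] by simp
  have app: "A # \<Gamma> \<turnstile> App \<up>?h (Var 0) \<Ztypecolon> \<up>B"
    using app_var0[OF A h[unfolded Arr_def]] by simp
  have "\<up>A # A # \<Gamma> \<turnstile> ren (upr Suc) (fst_tm \<up>B t) \<Ztypecolon> \<up>\<up>B"
    using weaken_under[OF s A] by simp
  from pi_beta[OF this var0[OF A]] have "A # \<Gamma> \<turnstile> App \<up>?h (Var 0) \<doteq> fst_tm \<up>B t \<Ztypecolon> \<up>B"
    by (simp del: fst_tm_ren)
  from id_sym[OF B1 app s id_of_eq[OF this B1 app]]
  have "A # \<Gamma> \<TTurnstile> R[[App \<up>?h (Var 0)]]"
    by (rule transport[OF B1 R s app _ snd_inh[OF B1 R t]])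
  with h show thesis by (rule that)
qed

lemma equiv_I:
  assumes X: "\<Gamma> \<turnstile> X \<Ztypecolon> Univ k" and Y: "\<Gamma> \<turnstile> Y \<Ztypecolon> Univ k"
    and h: "\<Gamma> \<turnstile> h \<Ztypecolon> Arr X Y" and g: "\<Gamma> \<turnstile> g \<Ztypecolon> Arr Y X"
    and "Y # \<Gamma> \<TTurnstile> TId \<up>Y (App \<up>h (App \<up>g (Var 0))) (Var 0)"
    and "X # \<Gamma> \<TTurnstile> TId \<up>X (App \<up>g (App \<up>h (Var 0))) (Var 0)"
  shows "\<Gamma> \<TTurnstile> Equiv X Y"
proof -
  note YX = Arr_form[OF Y X]
  note laws = inverse_laws_form[OF X Y h]
  note S = sig_form[OF YX laws(1)] sig_form[OF YX laws(2)]
  have "\<Gamma> \<TTurnstile> isEquiv X Y h"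
    unfolding isEquiv_def
    using inh_prod_I[OF S inh_sig_I[OF laws(1) g] inh_sig_I[OF laws(2) g]]
      inh_pi_I[OF assms(5)] inh_pi_I[OF assms(6)] by simp
  then show ?thesis
    unfolding Equiv_def using inh_sig_I[OF Equiv_form[OF X Y] h] by simp
qed

section \<open>The correspondence between the two types\<close>

text \<open>\<open>(g f)^n x\<close>\<close>
definition iter :: "tm \<Rightarrow> tm \<Rightarrow> tm \<Rightarrow> tm \<Rightarrow> tm \<Rightarrow> tm" where
  "iter X f g x n = IndNat \<up>X x (App \<up>\<up>g (App \<up>\<up>f (Var 0))) n"

lemma iter_ren [simp]: "ren r (iter X f g x n) = iter (ren r X) (ren r f) (ren r g) (ren r x) (ren r n)"
  and iter_sub [simp]: "sub s (iter X f g x n) = iter (sub s X) (sub s f) (sub s g) (sub s x) (sub s n)"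
  by (simp_all add: iter_def)

text \<open>\<open>x\<close> is a \<open>g\<close>-point: \<open>\<Prod> (x0 : X) (n : \<nat>). (g f)^n x0 = x \<rightarrow> fib g x0\<close>\<close>
definition isG :: "tm \<Rightarrow> tm \<Rightarrow> tm \<Rightarrow> tm \<Rightarrow> tm \<Rightarrow> tm" where
  "isG X Y f g x = TPi X (TPi TNat
     (Arr (TId \<up>\<up>X (iter \<up>\<up>X \<up>\<up>f \<up>\<up>g (Var 1) (Var 0)) \<up>\<up>x) (Fib \<up>\<up>Y \<up>\<up>X \<up>\<up>g (Var 1))))"

lemma isG_ren [simp]: "ren r (isG X Y f g x) = isG (ren r X) (ren r Y) (ren r f) (ren r g) (ren r x)"
  and isG_sub [simp]: "sub s (isG X Y f g x) = isG (sub s X) (sub s Y) (sub s f) (sub s g) (sub s x)"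
  by (simp_all add: isG_def)

text \<open>The graph of the bijection in the classical proof of Cantor, Schroeder and Bernstein.\<close>
definition CB :: "tm \<Rightarrow> tm \<Rightarrow> tm \<Rightarrow> tm \<Rightarrow> tm \<Rightarrow> tm \<Rightarrow> tm" where
  "CB X Y f g x y = TSum (Prod (isG X Y f g x) (TId X (App g y) x))
                          (Prod (Neg (isG X Y f g x)) (TId Y (App f x) y))"

lemma CB_ren [simp]: "ren r (CB X Y f g x y) = CB (ren r X) (ren r Y) (ren r f) (ren r g) (ren r x) (ren r y)"
  and CB_sub [simp]: "sub s (CB X Y f g x y) = CB (sub s X) (sub s Y) (sub s f) (sub s g) (sub s x) (sub s y)"
  by (simp_all add: CB_def)

lemma TNat_form: "\<Gamma> \<turnstile> a \<Ztypecolon> A \<Longrightarrow> \<Gamma> \<turnstile> TNat \<Ztypecolon> Univ i"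
  by (rule nat_form[OF typing_ctx])

locale embedding_pair =
  fixes \<Gamma> k X Y f g
  assumes X: "\<Gamma> \<turnstile> X \<Ztypecolon> Univ k" and Y: "\<Gamma> \<turnstile> Y \<Ztypecolon> Univ k"
    and f: "\<Gamma> \<turnstile> f \<Ztypecolon> Arr X Y" and g: "\<Gamma> \<turnstile> g \<Ztypecolon> Arr Y X"
    and f_emb: "\<Gamma> \<TTurnstile> isEmb X Y f" and g_emb: "\<Gamma> \<TTurnstile> isEmb Y X g"
    and LEM: "\<Gamma> \<TTurnstile> LEM k"
begin

lemma weakened: "weakens \<rho> \<Gamma> \<Delta> \<Longrightarrow> embedding_pair \<Delta> k (ren \<rho> X) (ren \<rho> Y) (ren \<rho> f) (ren \<rho> g)"
  using X Y f g f_emb g_emb LEM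
  by unfold_locales (fastforce dest: weakens_typ weakens_inh)+

lemmas ext = weakened[OF weakens_Suc]

lemmas fX = app_typ[OF f] and gY = app_typ[OF g]

lemma Nat: "\<Gamma> \<turnstile> TNat \<Ztypecolon> Univ i" by (rule TNat_form[OF X])

lemma iter_step_typ:
  "\<up>X # TNat # \<Gamma> \<turnstile> App \<up>\<up>g (App \<up>\<up>f (Var 0)) \<Ztypecolon> sub (Su (Var 1) \<bullet> shift 2) \<up>X"
proof -
  interpret e: embedding_pair "TNat # \<Gamma>" k "\<up>X" "\<up>Y" "\<up>f" "\<up>g" by (rule ext[OF Nat])
  interpret e2: embedding_pair "\<up>X # TNat # \<Gamma>" k "\<up>\<up>X" "\<up>\<up>Y" "\<up>\<up>f" "\<up>\<up>g" by (rule e.ext[OF e.X])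
  show ?thesis using e2.gY[OF e2.fX[OF var0[OF e.X]]] by simp
qed

lemma iter_typ: "\<Gamma> \<turnstile> x \<Ztypecolon> X \<Longrightarrow> \<Gamma> \<turnstile> n \<Ztypecolon> TNat \<Longrightarrow> \<Gamma> \<turnstile> iter X f g x n \<Ztypecolon> X"
  using nat_elim[OF weaken_type[OF X Nat] _ iter_step_typ] by (simp add: iter_def)

lemma iter_Ze: "\<Gamma> \<turnstile> x \<Ztypecolon> X \<Longrightarrow> \<Gamma> \<TTurnstile> TId X (iter X f g x Ze) x"
  using id_of_eq[OF _ X iter_typ[OF _ nat_intro1[OF typing_ctx]]]
    nat_beta1[OF weaken_type[OF X Nat] _ iter_step_typ] by (simp add: iter_def)

lemma iter_Su:
  "\<Gamma> \<turnstile> x \<Ztypecolon> X \<Longrightarrow> \<Gamma> \<turnstile> n \<Ztypecolon> TNat \<Longrightarrow>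
   \<Gamma> \<TTurnstile> TId X (iter X f g x (Su n)) (App g (App f (iter X f g x n)))"
  using id_of_eq[OF _ X iter_typ[OF _ nat_intro2]]
    nat_beta2[OF weaken_type[OF X Nat] _ iter_step_typ] by (simp add: iter_def)

lemma isG_body:
  assumes x: "\<Gamma> \<turnstile> x \<Ztypecolon> X"
  shows "TNat # X # \<Gamma> \<turnstile> TId \<up>\<up>X (iter \<up>\<up>X \<up>\<up>f \<up>\<up>g (Var 1) (Var 0)) \<up>\<up>x \<Ztypecolon> Univ k" (is "_ \<turnstile> ?I \<Ztypecolon> _")
    and "TNat # X # \<Gamma> \<turnstile> Fib \<up>\<up>Y \<up>\<up>X \<up>\<up>g (Var 1) \<Ztypecolon> Univ k"
    and "TNat # X # \<Gamma> \<TTurnstile> isProp (Fib \<up>\<up>Y \<up>\<up>X \<up>\<up>g (Var 1))"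
    and "TNat # X # \<Gamma> \<turnstile> Var 1 \<Ztypecolon> \<up>\<up>X"
    and "TNat # X # \<Gamma> \<turnstile> Var 0 \<Ztypecolon> TNat"
proof -
  interpret e: embedding_pair "X # \<Gamma>" k "\<up>X" "\<up>Y" "\<up>f" "\<up>g" by (rule ext[OF X])
  interpret e2: embedding_pair "TNat # X # \<Gamma>" k "\<up>\<up>X" "\<up>\<up>Y" "\<up>\<up>f" "\<up>\<up>g" by (rule e.ext[OF e.Nat])
  show v1: "TNat # X # \<Gamma> \<turnstile> Var 1 \<Ztypecolon> \<up>\<up>X"
    using weaken[OF var0[OF X] e.Nat] by simp
  show v0: "TNat # X # \<Gamma> \<turnstile> Var 0 \<Ztypecolon> TNat"
    using var0[OF e.Nat] by simp
  show "TNat # X # \<Gamma> \<turnstile> ?I \<Ztypecolon> Univ k"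
    by (rule id_form[OF e2.X e2.iter_typ[OF v1 v0] weaken[OF weaken[OF x X] e.Nat]])
  show "TNat # X # \<Gamma> \<turnstile> Fib \<up>\<up>Y \<up>\<up>X \<up>\<up>g (Var 1) \<Ztypecolon> Univ k"
    by (rule Fib_form(1)[OF e2.Y e2.X e2.g v1])
  show "TNat # X # \<Gamma> \<TTurnstile> isProp (Fib \<up>\<up>Y \<up>\<up>X \<up>\<up>g (Var 1))"
    using inh_pi_E[OF e2.g_emb[unfolded isEmb_def] v1] by simp
qed

lemma isG_form: "\<Gamma> \<turnstile> x \<Ztypecolon> X \<Longrightarrow> \<Gamma> \<turnstile> isG X Y f g x \<Ztypecolon> Univ k"
  unfolding isG_def using isG_body(1,2)[of x] X TNat_form[OF weaken_type[OF X X]]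
  by (auto intro!: pi_form Arr_form)

lemma isG_isProp:
  assumes x: "\<Gamma> \<turnstile> x \<Ztypecolon> X" shows "\<Gamma> \<TTurnstile> isProp (isG X Y f g x)"
proof -
  note b = isG_body[OF x]
  note N = TNat_form[OF weaken_type[OF X X]]
  note A = Arr_form[OF b(1,2)]
  have "TNat # X # \<Gamma> \<TTurnstile> isProp (Arr (TId \<up>\<up>X (iter \<up>\<up>X \<up>\<up>f \<up>\<up>g (Var 1) (Var 0)) \<up>\<up>x)
     (Fib \<up>\<up>Y \<up>\<up>X \<up>\<up>g (Var 1)))"
    using isProp_pi[OF b(1) weaken_type[OF b(2,1)]] inh_weaken[OF b(3,1)] by (simp add: Arr_def)
  from isProp_pi[OF X pi_form[OF N A] isProp_pi[OF N A this]]
  show ?thesis by (simp add: isG_def)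
qed

lemma isG_E:
  assumes "\<Gamma> \<TTurnstile> isG X Y f g x" "\<Gamma> \<turnstile> x0 \<Ztypecolon> X" "\<Gamma> \<turnstile> n \<Ztypecolon> TNat" "\<Gamma> \<TTurnstile> TId X (iter X f g x0 n) x"
  shows "\<Gamma> \<TTurnstile> Fib Y X g x0"
proof -
  have "\<Gamma> \<TTurnstile> TPi TNat (Arr (TId \<up>X (iter \<up>X \<up>f \<up>g \<up>x0 (Var 0)) \<up>x) (Fib \<up>Y \<up>X \<up>g \<up>x0))"
    using inh_pi_E[OF assms(1)[unfolded isG_def] assms(2)] by simp
  from inh_pi_E[OF this assms(3)] show ?thesis
    using assms(4) by (auto intro: inh_arr_E)
qed

lemma isG_I:
  assumes x: "\<Gamma> \<turnstile> x \<Ztypecolon> X"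
    and *: "\<And>\<Delta> \<rho> x0 n. weakens \<rho> \<Gamma> \<Delta> \<Longrightarrow> \<Delta> \<turnstile> x0 \<Ztypecolon> ren \<rho> X \<Longrightarrow> \<Delta> \<turnstile> n \<Ztypecolon> TNat \<Longrightarrow>
      \<Delta> \<TTurnstile> TId (ren \<rho> X) (iter (ren \<rho> X) (ren \<rho> f) (ren \<rho> g) x0 n) (ren \<rho> x) \<Longrightarrow>
      \<Delta> \<TTurnstile> Fib (ren \<rho> Y) (ren \<rho> X) (ren \<rho> g) x0"
  shows "\<Gamma> \<TTurnstile> isG X Y f g x"
  unfolding isG_def
proof (intro inh_pi_I)
  note b = isG_body[OF x]
  let ?\<Gamma> = "TNat # X # \<Gamma>"
  have W: "weakens (\<lambda>n. Suc (Suc n)) \<Gamma> ?\<Gamma>"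
    by (rule weakens_trans[OF weakens_Suc[OF X] weakens_Suc[OF TNat_form[OF weaken_type[OF X X]]]])
  show "?\<Gamma> \<TTurnstile> Arr (TId \<up>\<up>X (iter \<up>\<up>X \<up>\<up>f \<up>\<up>g (Var 1) (Var 0)) \<up>\<up>x) (Fib \<up>\<up>Y \<up>\<up>X \<up>\<up>g (Var 1))"
  proof (rule weakening_arr_I[OF b(1)])
    fix \<Delta> \<rho>
    assume w: "weakens \<rho> ?\<Gamma> \<Delta>" and p: "\<Delta> \<TTurnstile> ren \<rho> (TId \<up>\<up>X (iter \<up>\<up>X \<up>\<up>f \<up>\<up>g (Var 1) (Var 0)) \<up>\<up>x)"
    show "\<Delta> \<TTurnstile> ren \<rho> (Fib \<up>\<up>Y \<up>\<up>X \<up>\<up>g (Var 1))"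
      using *[OF weakens_trans[OF W w], of "Var (\<rho> 1)" "Var (\<rho> 0)"] p
        weakens_typ[OF w b(4)] weakens_typ[OF w b(5)]
      by (simp add: ren_ren)
  qed
qed

lemma isG_decidable:
  "\<Gamma> \<turnstile> x \<Ztypecolon> X \<Longrightarrow> \<Gamma> \<TTurnstile> TSum (isG X Y f g x) (Neg (isG X Y f g x))"
  by (rule LEM_E[OF LEM isG_form isG_isProp])

lemma isG_transport:
  assumes "\<Gamma> \<turnstile> x \<Ztypecolon> X" "\<Gamma> \<turnstile> x' \<Ztypecolon> X" "\<Gamma> \<TTurnstile> TId X x x'" "\<Gamma> \<TTurnstile> isG X Y f g x"
  shows "\<Gamma> \<TTurnstile> isG X Y f g x'"
  using transport[OF X embedding_pair.isG_form[OF ext[OF X] var0[OF X]] assms(1-3)] assms(4) by simp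

text \<open>If \<open>(g f)^n x0 = x\<close>, then \<open>(g f)^(n+1) x0 = g (f x)\<close>.\<close>
lemma g_fiber_of_shifted_iter:
  assumes x: "\<Gamma> \<turnstile> x \<Ztypecolon> X" and G: "\<Gamma> \<TTurnstile> isG X Y f g (App g (App f x))"
    and x0: "\<Gamma> \<turnstile> x0 \<Ztypecolon> X" and n: "\<Gamma> \<turnstile> n \<Ztypecolon> TNat"
    and p: "\<Gamma> \<TTurnstile> TId X (iter X f g x0 n) x"
  shows "\<Gamma> \<TTurnstile> Fib Y X g x0"
proof -
  note i = iter_typ[OF x0 n]
  have "\<Gamma> \<TTurnstile> TId X (App g (App f (iter X f g x0 n))) (App g (App f x))"
    by (intro id_app[OF Y X g] id_app[OF X Y f] fX i x p)
  then have "\<Gamma> \<TTurnstile> TId X (iter X f g x0 (Su n)) (App g (App f x))"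
    by (intro id_trans[OF X _ _ _ iter_Su]) (assumption | intro iter_typ gY fX nat_intro2 x0 n x)+
  then show ?thesis by (rule isG_E[OF G x0 nat_intro2[OF n]])
qed

lemma isG_of_isG_gf:
  assumes x: "\<Gamma> \<turnstile> x \<Ztypecolon> X" and G: "\<Gamma> \<TTurnstile> isG X Y f g (App g (App f x))"
  shows "\<Gamma> \<TTurnstile> isG X Y f g x"
proof (rule isG_I[OF x])
  fix \<Delta> \<rho> x0 n
  assume w: "weakens \<rho> \<Gamma> \<Delta>" and x0: "\<Delta> \<turnstile> x0 \<Ztypecolon> ren \<rho> X" and n: "\<Delta> \<turnstile> n \<Ztypecolon> TNat"
    and p: "\<Delta> \<TTurnstile> TId (ren \<rho> X) (iter (ren \<rho> X) (ren \<rho> f) (ren \<rho> g) x0 n) (ren \<rho> x)"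
  interpret e: embedding_pair \<Delta> k "ren \<rho> X" "ren \<rho> Y" "ren \<rho> f" "ren \<rho> g" by (rule weakened[OF w])
  show "\<Delta> \<TTurnstile> Fib (ren \<rho> Y) (ren \<rho> X) (ren \<rho> g) x0"
    using e.g_fiber_of_shifted_iter[OF weakens_typ[OF w x] _ x0 n p] weakens_inh[OF w G] by simp
qed

lemma Fib_I:
  assumes y: "\<Gamma> \<turnstile> y \<Ztypecolon> Y" and x: "\<Gamma> \<turnstile> x \<Ztypecolon> X" and p: "\<Gamma> \<TTurnstile> TId X (App g y) x"
  shows "\<Gamma> \<TTurnstile> Fib Y X g x"
  unfolding Fib_def wk_lift One_nat_def using inh_sig_I[OF Fib_form(2)[OF Y X g x] y] p by simp

abbreviation (input) "preimages_G y \<equiv> TPi X (Arr (TId \<up>Y (App \<up>f (Var 0)) \<up>y) (isG \<up>X \<up>Y \<up>f \<up>g (Var 0)))"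

lemma preimages_G_E:
  assumes "\<Gamma> \<TTurnstile> preimages_G y" "\<Gamma> \<turnstile> x \<Ztypecolon> X" "\<Gamma> \<TTurnstile> TId Y (App f x) y"
  shows "\<Gamma> \<TTurnstile> isG X Y f g x"
  using inh_pi_E[OF assms(1,2)] assms(3) by (auto intro: inh_arr_E)

text \<open>A path \<open>(g f)^0 x0 = g y\<close> puts \<open>x0\<close> in the image of \<open>g\<close> outright.\<close>
lemma g_fiber_zero:
  assumes y: "\<Gamma> \<turnstile> y \<Ztypecolon> Y" and x0: "\<Gamma> \<turnstile> x0 \<Ztypecolon> X"
    and p: "\<Gamma> \<TTurnstile> TId X (iter X f g x0 Ze) (App g y)"
  shows "\<Gamma> \<TTurnstile> Fib Y X g x0"
proof -
  note i = iter_typ[OF x0 nat_intro1[OF typing_ctx[OF x0]]]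
  show ?thesis
    by (rule Fib_I[OF y x0 id_trans[OF X gY[OF y] i x0 id_sym[OF X i gY[OF y] p] iter_Ze[OF x0]]])
qed

text \<open>From \<open>g (f ((g f)^n x0)) = g y\<close> it follows that \<open>(g f)^n x0\<close> is a preimage of \<open>y\<close>, hence a
  \<open>g\<close>-point, so its ancestor \<open>x0\<close> is in the image of \<open>g\<close>.\<close>
lemma g_fiber_succ:
  assumes y: "\<Gamma> \<turnstile> y \<Ztypecolon> Y" and all: "\<Gamma> \<TTurnstile> preimages_G y" and x0: "\<Gamma> \<turnstile> x0 \<Ztypecolon> X" and n: "\<Gamma> \<turnstile> n \<Ztypecolon> TNat"
    and p: "\<Gamma> \<TTurnstile> TId X (iter X f g x0 (Su n)) (App g y)"
  shows "\<Gamma> \<TTurnstile> Fib Y X g x0"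
proof -
  note i = iter_typ[OF x0 n] and i' = iter_typ[OF x0 nat_intro2[OF n]]
  note gfi = gY[OF fX[OF i]]
  have "\<Gamma> \<TTurnstile> TId X (App g (App f (iter X f g x0 n))) (App g y)"
    by (rule id_trans[OF X gfi i' gY[OF y] id_sym[OF X i' gfi iter_Su[OF x0 n]] p])
  then have "\<Gamma> \<TTurnstile> TId Y (App f (iter X f g x0 n)) y"
    by (rule emb_cancel[OF Y X g g_emb fX[OF i] y])
  then show ?thesis
    using isG_E[OF preimages_G_E[OF all i] x0 n id_refl[OF X i]] by simp
qed

lemma g_fiber_of_preimages_G:
  assumes y: "\<Gamma> \<turnstile> y \<Ztypecolon> Y" and all: "\<Gamma> \<TTurnstile> preimages_G y" and x0: "\<Gamma> \<turnstile> x0 \<Ztypecolon> X" and n: "\<Gamma> \<turnstile> n \<Ztypecolon> TNat"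
    and p: "\<Gamma> \<TTurnstile> TId X (iter X f g x0 n) (App g y)"
  shows "\<Gamma> \<TTurnstile> Fib Y X g x0"
proof -
  \<comment> \<open>Case distinction on \<open>n\<close> changes the type of \<open>p\<close>, so the motive includes it as a hypothesis.\<close>
  let ?C = "Arr (TId \<up>X (iter \<up>X \<up>f \<up>g \<up>x0 (Var 0)) (App \<up>g \<up>y)) (Fib \<up>Y \<up>X \<up>g \<up>x0)"
  have I: "\<Gamma> \<turnstile> TId X (iter X f g x0 m) (App g y) \<Ztypecolon> Univ k" if "\<Gamma> \<turnstile> m \<Ztypecolon> TNat" for m
    by (rule id_form[OF X iter_typ[OF x0 that] gY[OF y]])
  interpret N: embedding_pair "TNat # \<Gamma>" k "\<up>X" "\<up>Y" "\<up>f" "\<up>g" by (rule ext[OF Nat])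
  have v: "TNat # \<Gamma> \<turnstile> Var 0 \<Ztypecolon> TNat" using var0[OF Nat] by simp
  note x1 = weaken[OF x0 Nat] and y1 = weaken[OF y Nat]
  have IN: "TNat # \<Gamma> \<turnstile> TId \<up>X (iter \<up>X \<up>f \<up>g \<up>x0 m) (App \<up>g \<up>y) \<Ztypecolon> Univ k" if "TNat # \<Gamma> \<turnstile> m \<Ztypecolon> TNat" for m
    by (rule id_form[OF N.X N.iter_typ[OF x1 that] N.gY[OF y1]])
  have "\<Gamma> \<TTurnstile> ?C[[n]]"
  proof (rule inh_nat_cases)
    show "TNat # \<Gamma> \<turnstile> ?C \<Ztypecolon> Univ k"
      by (rule Arr_form[OF IN[OF v] Fib_form(1)[OF N.Y N.X N.g x1]])
    have "\<Gamma> \<TTurnstile> Arr (TId X (iter X f g x0 Ze) (App g y)) (Fib Y X g x0)"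
    proof (rule weakening_arr_I[OF I[OF nat_intro1[OF typing_ctx[OF y]]]])
      fix \<Delta> \<rho>
      assume w: "weakens \<rho> \<Gamma> \<Delta>" and q: "\<Delta> \<TTurnstile> ren \<rho> (TId X (iter X f g x0 Ze) (App g y))"
      interpret e: embedding_pair \<Delta> k "ren \<rho> X" "ren \<rho> Y" "ren \<rho> f" "ren \<rho> g" by (rule weakened[OF w])
      show "\<Delta> \<TTurnstile> ren \<rho> (Fib Y X g x0)"
        using e.g_fiber_zero[OF weakens_typ[OF w y] weakens_typ[OF w x0]] q by simp
    qed
    then show "\<Gamma> \<TTurnstile> ?C[[Ze]]" by simp
    have "TNat # \<Gamma> \<TTurnstile> Arr (TId \<up>X (iter \<up>X \<up>f \<up>g \<up>x0 (Su (Var 0))) (App \<up>g \<up>y)) (Fib \<up>Y \<up>X \<up>g \<up>x0)"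
    proof (rule weakening_arr_I[OF IN[OF nat_intro2[OF v]]])
      fix \<Delta> \<rho>
      assume w: "weakens \<rho> (TNat # \<Gamma>) \<Delta>"
        and q: "\<Delta> \<TTurnstile> ren \<rho> (TId \<up>X (iter \<up>X \<up>f \<up>g \<up>x0 (Su (Var 0))) (App \<up>g \<up>y))"
      interpret e: embedding_pair \<Delta> k "ren \<rho> \<up>X" "ren \<rho> \<up>Y" "ren \<rho> \<up>f" "ren \<rho> \<up>g" by (rule N.weakened[OF w])
      show "\<Delta> \<TTurnstile> ren \<rho> (Fib \<up>Y \<up>X \<up>g \<up>x0)"
        using e.g_fiber_succ[OF weakens_typ[OF w y1] _ weakens_typ[OF w x1], of "Var (\<rho> 0)"]
          q weakens_inh[OF w inh_weaken[OF all Nat]] weakens_typ[OF w v] by simp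
    qed
    then show "TNat # \<Gamma> \<TTurnstile> sub (Su (Var 0) \<bullet> shift 1) ?C" by simp
  qed (rule n)
  then show ?thesis using p by (auto intro: inh_arr_E)
qed

lemma isG_g_of_preimages_G:
  assumes y: "\<Gamma> \<turnstile> y \<Ztypecolon> Y" and all: "\<Gamma> \<TTurnstile> preimages_G y"
  shows "\<Gamma> \<TTurnstile> isG X Y f g (App g y)"
proof (rule isG_I[OF gY[OF y]])
  fix \<Delta> \<rho> x0 n
  assume w: "weakens \<rho> \<Gamma> \<Delta>" and x0: "\<Delta> \<turnstile> x0 \<Ztypecolon> ren \<rho> X" and n: "\<Delta> \<turnstile> n \<Ztypecolon> TNat"
    and p: "\<Delta> \<TTurnstile> TId (ren \<rho> X) (iter (ren \<rho> X) (ren \<rho> f) (ren \<rho> g) x0 n) (ren \<rho> (App g y))"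
  interpret e: embedding_pair \<Delta> k "ren \<rho> X" "ren \<rho> Y" "ren \<rho> f" "ren \<rho> g" by (rule weakened[OF w])
  show "\<Delta> \<TTurnstile> Fib (ren \<rho> Y) (ren \<rho> X) (ren \<rho> g) x0"
    using e.g_fiber_of_preimages_G[OF weakens_typ[OF w y] _ x0 n] weakens_inh[OF w all] p by simp
qed

lemma preimages_G_I:
  assumes y: "\<Gamma> \<turnstile> y \<Ztypecolon> Y"
    and *: "\<And>\<Delta> \<rho> x. weakens \<rho> \<Gamma> \<Delta> \<Longrightarrow> \<Delta> \<turnstile> x \<Ztypecolon> ren \<rho> X \<Longrightarrow>
      \<Delta> \<TTurnstile> TId (ren \<rho> Y) (App (ren \<rho> f) x) (ren \<rho> y) \<Longrightarrow>
      \<Delta> \<TTurnstile> isG (ren \<rho> X) (ren \<rho> Y) (ren \<rho> f) (ren \<rho> g) x"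
  shows "\<Gamma> \<TTurnstile> preimages_G y"
proof (intro inh_pi_I weakening_arr_I)
  note v = var0[OF X]
  show "X # \<Gamma> \<turnstile> TId \<up>Y (App \<up>f (Var 0)) \<up>y \<Ztypecolon> Univ k"
    by (rule Fib_form(2)[OF X Y f y])
  fix \<Delta> \<rho>
  assume w: "weakens \<rho> (X # \<Gamma>) \<Delta>" and q: "\<Delta> \<TTurnstile> ren \<rho> (TId \<up>Y (App \<up>f (Var 0)) \<up>y)"
  show "\<Delta> \<TTurnstile> ren \<rho> (isG \<up>X \<up>Y \<up>f \<up>g (Var 0))"
    using *[OF weakens_trans[OF weakens_Suc[OF X] w], of "Var (\<rho> 0)"] q weakens_typ[OF w v]
    by (simp add: ren_ren)
qed

lemma f_fiber_isProp: "\<Gamma> \<turnstile> y \<Ztypecolon> Y \<Longrightarrow> \<Gamma> \<TTurnstile> isProp (Fib X Y f y)"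
  using inh_pi_E[OF f_emb[unfolded isEmb_def]] by simp

text \<open>If the fibre of \<open>f\<close> over \<open>y\<close> were empty, all preimages of \<open>y\<close> would vacuously be
  \<open>g\<close>-points, and so would \<open>g y\<close>. Excluded middle, applied to the fibre, yields a point of it.\<close>
lemma f_fiber_of_not_isG_g:
  assumes y: "\<Gamma> \<turnstile> y \<Ztypecolon> Y" and no: "\<Gamma> \<TTurnstile> Neg (isG X Y f g (App g y))"
  obtains x where "\<Gamma> \<turnstile> x \<Ztypecolon> X" "\<Gamma> \<TTurnstile> TId Y (App f x) y"
proof -
  note F = Fib_form[OF X Y f y]
  have "\<Gamma> \<TTurnstile> Fib X Y f y"
  proof (rule weakening_sum_E[OF LEM_E[OF LEM F(1) f_fiber_isProp[OF y]] F(1) Neg_form[OF F(1)] F(1)])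
    fix \<Delta> \<rho>
    assume w: "weakens \<rho> \<Gamma> \<Delta>" and nF: "\<Delta> \<TTurnstile> ren \<rho> (Neg (Fib X Y f y))"
    interpret e: embedding_pair \<Delta> k "ren \<rho> X" "ren \<rho> Y" "ren \<rho> f" "ren \<rho> g" by (rule weakened[OF w])
    note y' = weakens_typ[OF w y]
    have "\<Delta> \<TTurnstile> e.preimages_G (ren \<rho> y)"
    proof (rule e.preimages_G_I[OF y'])
      fix \<Theta> \<sigma> x
      let ?r = "\<lambda>t. ren \<sigma> (ren \<rho> t)"
      assume v: "weakens \<sigma> \<Delta> \<Theta>" and x: "\<Theta> \<turnstile> x \<Ztypecolon> ?r X" and p: "\<Theta> \<TTurnstile> TId (?r Y) (App (?r f) x) (?r y)"
      interpret e': embedding_pair \<Theta> k "?r X" "?r Y" "?r f" "?r g" by (rule e.weakened[OF v])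
      have "\<Theta> \<TTurnstile> Fib (?r X) (?r Y) (?r f) (?r y)"
        unfolding Fib_def using inh_sig_I[OF Fib_form(2)[OF e'.X e'.Y e'.f weakens_typ[OF v y']] x] p by simp
      then show "\<Theta> \<TTurnstile> isG (?r X) (?r Y) (?r f) (?r g) x"
        using inh_neg_E[OF _ _ e'.isG_form[OF x]] weakens_inh[OF v nF] by simp
    qed
    from inh_neg_E[OF weakens_inh[OF w no, simplified] e.isG_g_of_preimages_G[OF y' this, simplified]]
    show "\<Delta> \<TTurnstile> ren \<rho> (Fib X Y f y)" using weakens_type[OF w F(1)] .
  qed
  then show thesis
    unfolding Fib_def by (rule inh_sig_E[OF _ X]) (use F(2) that in simp_all)
qed

text \<open>As \<open>f\<close> is left-cancellable, all preimages of \<open>y\<close> are equal to \<open>x\<close>; if \<open>x\<close> were a \<open>g\<close>-point, all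
  of them would be, and so would \<open>g y\<close>.\<close>
lemma not_isG_of_not_isG_g:
  assumes y: "\<Gamma> \<turnstile> y \<Ztypecolon> Y" and no: "\<Gamma> \<TTurnstile> Neg (isG X Y f g (App g y))"
    and x: "\<Gamma> \<turnstile> x \<Ztypecolon> X" and p: "\<Gamma> \<TTurnstile> TId Y (App f x) y"
  shows "\<Gamma> \<TTurnstile> Neg (isG X Y f g x)"
proof (rule weakening_neg_I[OF isG_form[OF x]])
  fix \<Delta> \<rho>
  assume w: "weakens \<rho> \<Gamma> \<Delta>" and G: "\<Delta> \<TTurnstile> ren \<rho> (isG X Y f g x)"
  interpret e: embedding_pair \<Delta> k "ren \<rho> X" "ren \<rho> Y" "ren \<rho> f" "ren \<rho> g" by (rule weakened[OF w])
  note y' = weakens_typ[OF w y] and x' = weakens_typ[OF w x] and p' = weakens_inh[OF w p, simplified]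
  have "\<Delta> \<TTurnstile> e.preimages_G (ren \<rho> y)"
  proof (rule e.preimages_G_I[OF y'])
    fix \<Theta> \<sigma> z
    let ?r = "\<lambda>t. ren \<sigma> (ren \<rho> t)"
    assume v: "weakens \<sigma> \<Delta> \<Theta>" and z: "\<Theta> \<turnstile> z \<Ztypecolon> ?r X" and q: "\<Theta> \<TTurnstile> TId (?r Y) (App (?r f) z) (?r y)"
    interpret e': embedding_pair \<Theta> k "?r X" "?r Y" "?r f" "?r g" by (rule e.weakened[OF v])
    note y'' = weakens_typ[OF v y'] and x'' = weakens_typ[OF v x'] and p'' = weakens_inh[OF v p', simplified]
    have "\<Theta> \<TTurnstile> TId (?r Y) (App (?r f) (?r x)) (App (?r f) z)"
      by (rule id_trans[OF e'.Y e'.fX[OF x''] y'' e'.fX[OF z] p'' id_sym[OF e'.Y e'.fX[OF z] y'' q]])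
    from e'.isG_transport[OF x'' z emb_cancel[OF e'.X e'.Y e'.f e'.f_emb x'' z this]]
    show "\<Theta> \<TTurnstile> isG (?r X) (?r Y) (?r f) (?r g) z"
      using weakens_inh[OF v G] by simp
  qed
  from inh_neg_E[OF weakens_inh[OF w no, simplified] e.isG_g_of_preimages_G[OF y' this, simplified]
      empty_form[OF typing_ctx[OF e.X]]]
  show "\<Delta> \<TTurnstile> TEmpty" .
qed

abbreviation (input) "R x y \<equiv> CB X Y f g x y"

lemma R_ids_form:
  assumes "\<Gamma> \<turnstile> x \<Ztypecolon> X" "\<Gamma> \<turnstile> y \<Ztypecolon> Y"
  shows "\<Gamma> \<turnstile> TId X (App g y) x \<Ztypecolon> Univ k" "\<Gamma> \<turnstile> TId Y (App f x) y \<Ztypecolon> Univ k"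
  using assms by (auto intro: id_form X Y fX gY)

lemma R_summands_form: assumes "\<Gamma> \<turnstile> x \<Ztypecolon> X" "\<Gamma> \<turnstile> y \<Ztypecolon> Y"
  shows "\<Gamma> \<turnstile> Prod (isG X Y f g x) (TId X (App g y) x) \<Ztypecolon> Univ k"
    "\<Gamma> \<turnstile> Prod (Neg (isG X Y f g x)) (TId Y (App f x) y) \<Ztypecolon> Univ k"
  using R_ids_form[OF assms] isG_form[OF assms(1)] by (auto intro: Prod_form Neg_form)

lemma R_form: "\<Gamma> \<turnstile> x \<Ztypecolon> X \<Longrightarrow> \<Gamma> \<turnstile> y \<Ztypecolon> Y \<Longrightarrow> \<Gamma> \<turnstile> R x y \<Ztypecolon> Univ k"
  unfolding CB_def by (intro sum_form R_summands_form)

lemma R_I1: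
  assumes "\<Gamma> \<turnstile> x \<Ztypecolon> X" "\<Gamma> \<turnstile> y \<Ztypecolon> Y" "\<Gamma> \<TTurnstile> isG X Y f g x" "\<Gamma> \<TTurnstile> TId X (App g y) x"
  shows "\<Gamma> \<TTurnstile> R x y"
  unfolding CB_def
  by (rule inh_sum_I1[OF R_summands_form[OF assms(1,2)] inh_prod_I[OF isG_form[OF assms(1)] R_ids_form(1)[OF assms(1,2)] assms(3,4)]])

lemma R_I2:
  assumes "\<Gamma> \<turnstile> x \<Ztypecolon> X" "\<Gamma> \<turnstile> y \<Ztypecolon> Y" "\<Gamma> \<TTurnstile> Neg (isG X Y f g x)" "\<Gamma> \<TTurnstile> TId Y (App f x) y"
  shows "\<Gamma> \<TTurnstile> R x y"
  unfolding CB_def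
  by (rule inh_sum_I2[OF R_summands_form[OF assms(1,2)] inh_prod_I[OF Neg_form[OF isG_form[OF assms(1)]] R_ids_form(2)[OF assms(1,2)] assms(3,4)]])

lemma R_E:
  assumes R: "\<Gamma> \<TTurnstile> R x y" and x: "\<Gamma> \<turnstile> x \<Ztypecolon> X" and y: "\<Gamma> \<turnstile> y \<Ztypecolon> Y" and C: "\<Gamma> \<turnstile> C \<Ztypecolon> Univ j"
    and 1: "\<And>\<Delta> \<rho>. weakens \<rho> \<Gamma> \<Delta> \<Longrightarrow> \<Delta> \<TTurnstile> ren \<rho> (isG X Y f g x) \<Longrightarrow> \<Delta> \<TTurnstile> ren \<rho> (TId X (App g y) x) \<Longrightarrow> \<Delta> \<TTurnstile> ren \<rho> C"
    and 2: "\<And>\<Delta> \<rho>. weakens \<rho> \<Gamma> \<Delta> \<Longrightarrow> \<Delta> \<TTurnstile> ren \<rho> (Neg (isG X Y f g x)) \<Longrightarrow> \<Delta> \<TTurnstile> ren \<rho> (TId Y (App f x) y) \<Longrightarrow> \<Delta> \<TTurnstile> ren \<rho> C"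
  shows "\<Gamma> \<TTurnstile> C"
proof (rule weakening_sum_E[OF R[unfolded CB_def] R_summands_form[OF x y] C])
  fix \<Delta> \<rho> assume w: "weakens \<rho> \<Gamma> \<Delta>"
  note F = weakens_type[OF w isG_form[OF x]] weakens_type[OF w R_ids_form(1)[OF x y]]
    Neg_form[OF weakens_type[OF w isG_form[OF x]]] weakens_type[OF w R_ids_form(2)[OF x y]]
  { assume "\<Delta> \<TTurnstile> ren \<rho> (Prod (isG X Y f g x) (TId X (App g y) x))"
    then show "\<Delta> \<TTurnstile> ren \<rho> C" using inh_prod_E[OF _ F(1,2)] by (intro 1[OF w]) simp_all }
  { assume "\<Delta> \<TTurnstile> ren \<rho> (Prod (Neg (isG X Y f g x)) (TId Y (App f x) y))"
    then show "\<Delta> \<TTurnstile> ren \<rho> C" using inh_prod_E[OF _ F(3,4)] by (intro 2[OF w]) simp_all }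
qed

text \<open>Once the kind of \<open>x\<close> is known, only one alternative of the correspondence is possible.\<close>
lemma R_of_isG:
  assumes R: "\<Gamma> \<TTurnstile> R x y" and x: "\<Gamma> \<turnstile> x \<Ztypecolon> X" and y: "\<Gamma> \<turnstile> y \<Ztypecolon> Y" and G: "\<Gamma> \<TTurnstile> isG X Y f g x"
  shows "\<Gamma> \<TTurnstile> TId X (App g y) x"
proof (rule R_E[OF R x y R_ids_form(1)[OF x y]])
  fix \<Delta> \<rho> assume w: "weakens \<rho> \<Gamma> \<Delta>" and n: "\<Delta> \<TTurnstile> ren \<rho> (Neg (isG X Y f g x))"
  show "\<Delta> \<TTurnstile> ren \<rho> (TId X (App g y) x)"
    using inh_neg_E[OF _ weakens_inh[OF w G] weakens_type[OF w R_ids_form(1)[OF x y]]] n by simp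
qed

lemma R_of_not_isG:
  assumes R: "\<Gamma> \<TTurnstile> R x y" and x: "\<Gamma> \<turnstile> x \<Ztypecolon> X" and y: "\<Gamma> \<turnstile> y \<Ztypecolon> Y" and N: "\<Gamma> \<TTurnstile> Neg (isG X Y f g x)"
  shows "\<Gamma> \<TTurnstile> TId Y (App f x) y"
proof (rule R_E[OF R x y R_ids_form(2)[OF x y]])
  fix \<Delta> \<rho> assume w: "weakens \<rho> \<Gamma> \<Delta>" and n: "\<Delta> \<TTurnstile> ren \<rho> (isG X Y f g x)"
  show "\<Delta> \<TTurnstile> ren \<rho> (TId Y (App f x) y)"
    using inh_neg_E[OF _ n weakens_type[OF w R_ids_form(2)[OF x y]]] weakens_inh[OF w N] by simp
qed

lemma R_functional:
  assumes x: "\<Gamma> \<turnstile> x \<Ztypecolon> X" and y: "\<Gamma> \<turnstile> y \<Ztypecolon> Y" and y': "\<Gamma> \<turnstile> y' \<Ztypecolon> Y"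
    and R: "\<Gamma> \<TTurnstile> R x y" and R': "\<Gamma> \<TTurnstile> R x y'"
  shows "\<Gamma> \<TTurnstile> TId Y y y'"
proof (rule R_E[OF R x y id_form[OF Y y y']])
  fix \<Delta> \<rho> assume w: "weakens \<rho> \<Gamma> \<Delta>"
  interpret e: embedding_pair \<Delta> k "ren \<rho> X" "ren \<rho> Y" "ren \<rho> f" "ren \<rho> g" by (rule weakened[OF w])
  note x1 = weakens_typ[OF w x] and y1 = weakens_typ[OF w y] and y1' = weakens_typ[OF w y']
    and R1 = weakens_inh[OF w R', simplified]
  { assume G: "\<Delta> \<TTurnstile> ren \<rho> (isG X Y f g x)" and p: "\<Delta> \<TTurnstile> ren \<rho> (TId X (App g y) x)"
    note g1 = e.gY[OF y1] and g1' = e.gY[OF y1']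
    note q = id_trans[OF e.X g1 x1 g1' p[simplified] id_sym[OF e.X g1' x1 e.R_of_isG[OF R1 x1 y1' G[simplified]]]]
    show "\<Delta> \<TTurnstile> ren \<rho> (TId Y y y')"
      using emb_cancel[OF e.Y e.X e.g e.g_emb y1 y1' q] by simp }
  { assume N: "\<Delta> \<TTurnstile> ren \<rho> (Neg (isG X Y f g x))" and p: "\<Delta> \<TTurnstile> ren \<rho> (TId Y (App f x) y)"
    note fx = e.fX[OF x1]
    show "\<Delta> \<TTurnstile> ren \<rho> (TId Y y y')"
      using id_trans[OF e.Y y1 fx y1' id_sym[OF e.Y fx y1 p[simplified]] e.R_of_not_isG[OF R1 x1 y1' N[simplified]]] by simp }
qed

text \<open>Two points of different kinds cannot have the same partner: here \<open>g (f x') = g y = x\<close>, so \<open>x'\<close>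
  inherits the kind of \<open>x\<close>.\<close>
lemma R_mixed:
  assumes x: "\<Gamma> \<turnstile> x \<Ztypecolon> X" and x': "\<Gamma> \<turnstile> x' \<Ztypecolon> X" and y: "\<Gamma> \<turnstile> y \<Ztypecolon> Y"
    and G: "\<Gamma> \<TTurnstile> isG X Y f g x" and p: "\<Gamma> \<TTurnstile> TId X (App g y) x" and q: "\<Gamma> \<TTurnstile> TId Y (App f x') y"
  shows "\<Gamma> \<TTurnstile> isG X Y f g x'"
proof (rule isG_of_isG_gf[OF x'])
  have "\<Gamma> \<TTurnstile> TId X (App g (App f x')) x"
    by (rule id_trans[OF X gY[OF fX[OF x']] gY[OF y] x id_app[OF Y X g fX[OF x'] y q] p])
  then show "\<Gamma> \<TTurnstile> isG X Y f g (App g (App f x'))"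
    by (intro isG_transport[OF x gY[OF fX[OF x']] _ G] id_sym[OF X gY[OF fX[OF x']] x])
qed

lemma R_injective:
  assumes x: "\<Gamma> \<turnstile> x \<Ztypecolon> X" and x': "\<Gamma> \<turnstile> x' \<Ztypecolon> X" and y: "\<Gamma> \<turnstile> y \<Ztypecolon> Y"
    and R: "\<Gamma> \<TTurnstile> R x y" and R': "\<Gamma> \<TTurnstile> R x' y"
  shows "\<Gamma> \<TTurnstile> TId X x x'"
proof -
  note C = id_form[OF X x x']
  show ?thesis
  proof (rule R_E[OF R x y C])
    fix \<Delta> \<rho> assume w: "weakens \<rho> \<Gamma> \<Delta>"
    let ?r = "ren \<rho>"
    interpret e: embedding_pair \<Delta> k "?r X" "?r Y" "?r f" "?r g" by (rule weakened[OF w])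
    note x1 = weakens_typ[OF w x] and x1' = weakens_typ[OF w x'] and y1 = weakens_typ[OF w y]
      and R1 = weakens_inh[OF w R', simplified] and C1 = weakens_type[OF w C]
    { assume G: "\<Delta> \<TTurnstile> ?r (isG X Y f g x)" and p: "\<Delta> \<TTurnstile> ?r (TId X (App g y) x)"
      show "\<Delta> \<TTurnstile> ?r (TId X x x')"
      proof (rule e.R_E[OF R1 x1' y1 C1])
        fix \<Theta> \<sigma> assume v: "weakens \<sigma> \<Delta> \<Theta>"
        let ?s = "\<lambda>t. ren \<sigma> (ren \<rho> t)"
        interpret e': embedding_pair \<Theta> k "?s X" "?s Y" "?s f" "?s g" by (rule e.weakened[OF v])
        note x2 = weakens_typ[OF v x1] and x2' = weakens_typ[OF v x1'] and y2 = weakens_typ[OF v y1]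
          and p2 = weakens_inh[OF v p, simplified] and G2 = weakens_inh[OF v G, simplified]
        { assume "\<Theta> \<TTurnstile> ren \<sigma> (TId (?r X) (App (?r g) (?r y)) (?r x'))"
          then show "\<Theta> \<TTurnstile> ?s (TId X x x')"
            using id_trans[OF e'.X x2 e'.gY[OF y2] x2' id_sym[OF e'.X e'.gY[OF y2] x2 p2]] by simp }
        { assume "\<Theta> \<TTurnstile> ren \<sigma> (Neg (isG (?r X) (?r Y) (?r f) (?r g) (?r x')))"
            "\<Theta> \<TTurnstile> ren \<sigma> (TId (?r Y) (App (?r f) (?r x')) (?r y))"
          then show "\<Theta> \<TTurnstile> ?s (TId X x x')"
            using inh_neg_E[OF _ e'.R_mixed[OF x2 x2' y2 G2 p2]] weakens_type[OF v C1] by simp }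
      qed }
    { assume N: "\<Delta> \<TTurnstile> ?r (Neg (isG X Y f g x))" and p: "\<Delta> \<TTurnstile> ?r (TId Y (App f x) y)"
      show "\<Delta> \<TTurnstile> ?r (TId X x x')"
      proof (rule e.R_E[OF R1 x1' y1 C1])
        fix \<Theta> \<sigma> assume v: "weakens \<sigma> \<Delta> \<Theta>"
        let ?s = "\<lambda>t. ren \<sigma> (ren \<rho> t)"
        interpret e': embedding_pair \<Theta> k "?s X" "?s Y" "?s f" "?s g" by (rule e.weakened[OF v])
        note x2 = weakens_typ[OF v x1] and x2' = weakens_typ[OF v x1'] and y2 = weakens_typ[OF v y1]
          and p2 = weakens_inh[OF v p, simplified] and N2 = weakens_inh[OF v N, simplified]
        { assume "\<Theta> \<TTurnstile> ren \<sigma> (TId (?r Y) (App (?r f) (?r x')) (?r y))"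
          then have "\<Theta> \<TTurnstile> TId (?s Y) (App (?s f) (?s x)) (App (?s f) (?s x'))"
            using id_trans[OF e'.Y e'.fX[OF x2] y2 e'.fX[OF x2'] p2 id_sym[OF e'.Y e'.fX[OF x2'] y2]] by simp
          from emb_cancel[OF e'.X e'.Y e'.f e'.f_emb x2 x2' this]
          show "\<Theta> \<TTurnstile> ?s (TId X x x')" by simp }
        { assume "\<Theta> \<TTurnstile> ren \<sigma> (isG (?r X) (?r Y) (?r f) (?r g) (?r x'))"
            "\<Theta> \<TTurnstile> ren \<sigma> (TId (?r X) (App (?r g) (?r y)) (?r x'))"
          then show "\<Theta> \<TTurnstile> ?s (TId X x x')"
            using inh_neg_E[OF N2 e'.R_mixed[OF x2' x2 y2 _ _ p2]] weakens_type[OF v C1] by simp }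
      qed }
  qed
qed

lemma R_form_fst:
  assumes "\<Gamma> \<turnstile> y \<Ztypecolon> Y"
  shows "X # \<Gamma> \<turnstile> CB \<up>X \<up>Y \<up>f \<up>g (Var 0) \<up>y \<Ztypecolon> Univ k"
  by (rule embedding_pair.R_form[OF ext[OF X] var0[OF X] weaken[OF assms X]])

lemma R_form_snd:
  assumes "\<Gamma> \<turnstile> x \<Ztypecolon> X"
  shows "Y # \<Gamma> \<turnstile> CB \<up>X \<up>Y \<up>f \<up>g \<up>x (Var 0) \<Ztypecolon> Univ k"
  by (rule embedding_pair.R_form[OF ext[OF Y] weaken[OF assms Y] var0[OF Y]])

lemma g_fiber_E:
  assumes "\<Gamma> \<turnstile> x \<Ztypecolon> X" "\<Gamma> \<TTurnstile> Fib Y X g x"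
  obtains y where "\<Gamma> \<turnstile> y \<Ztypecolon> Y" "\<Gamma> \<TTurnstile> TId X (App g y) x"
  using assms(2)
  unfolding Fib_def by (rule inh_sig_E[OF _ Y]) (use Fib_form(2)[OF Y X g assms(1)] that in simp_all)

text \<open>A \<open>g\<close>-point \<open>x\<close> is in the image of \<open>g\<close>, by its definition for \<open>n = 0\<close> and \<open>x0 = x\<close>.\<close>
lemma R_total:
  assumes x: "\<Gamma> \<turnstile> x \<Ztypecolon> X"
  shows "\<Gamma> \<TTurnstile> TSig Y (CB \<up>X \<up>Y \<up>f \<up>g \<up>x (Var 0))" (is "_ \<TTurnstile> ?S")
proof (rule weakening_sum_E[OF isG_decidable[OF x] isG_form[OF x] Neg_form[OF isG_form[OF x]] sig_form[OF Y R_form_snd[OF x]]])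
  fix \<Delta> \<rho> assume w: "weakens \<rho> \<Gamma> \<Delta>"
  interpret e: embedding_pair \<Delta> k "ren \<rho> X" "ren \<rho> Y" "ren \<rho> f" "ren \<rho> g" by (rule weakened[OF w])
  note x1 = weakens_typ[OF w x]
  { assume "\<Delta> \<TTurnstile> ren \<rho> (isG X Y f g x)"
    then have G: "\<Delta> \<TTurnstile> isG (ren \<rho> X) (ren \<rho> Y) (ren \<rho> f) (ren \<rho> g) (ren \<rho> x)" by simp
    note z = nat_intro1[OF typing_ctx[OF x1]]
    obtain y where y: "\<Delta> \<turnstile> y \<Ztypecolon> ren \<rho> Y" and p: "\<Delta> \<TTurnstile> TId (ren \<rho> X) (App (ren \<rho> g) y) (ren \<rho> x)"
      by (rule e.g_fiber_E[OF x1 e.isG_E[OF G x1 z e.iter_Ze[OF x1]]])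
    from inh_sig_I[OF e.R_form_snd[OF x1] y] e.R_I1[OF x1 y G p] show "\<Delta> \<TTurnstile> ren \<rho> ?S" by simp }
  { assume N: "\<Delta> \<TTurnstile> ren \<rho> (Neg (isG X Y f g x))"
    note y = e.fX[OF x1]
    from inh_sig_I[OF e.R_form_snd[OF x1] y] e.R_I2[OF x1 y N[simplified] id_refl[OF e.Y y]]
    show "\<Delta> \<TTurnstile> ren \<rho> ?S" by simp }
qed

lemma R_cototal:
  assumes y: "\<Gamma> \<turnstile> y \<Ztypecolon> Y"
  shows "\<Gamma> \<TTurnstile> TSig X (CB \<up>X \<up>Y \<up>f \<up>g (Var 0) \<up>y)" (is "_ \<TTurnstile> ?S")
proof (rule weakening_sum_E[OF isG_decidable isG_form Neg_form[OF isG_form] sig_form[OF X R_form_fst[OF y]]])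
  show "\<Gamma> \<turnstile> App g y \<Ztypecolon> X" "\<Gamma> \<turnstile> App g y \<Ztypecolon> X" "\<Gamma> \<turnstile> App g y \<Ztypecolon> X" by (rule gY[OF y])+
  fix \<Delta> \<rho> assume w: "weakens \<rho> \<Gamma> \<Delta>"
  interpret e: embedding_pair \<Delta> k "ren \<rho> X" "ren \<rho> Y" "ren \<rho> f" "ren \<rho> g" by (rule weakened[OF w])
  note y1 = weakens_typ[OF w y]
  { assume G: "\<Delta> \<TTurnstile> ren \<rho> (isG X Y f g (App g y))"
    note x = e.gY[OF y1]
    from inh_sig_I[OF e.R_form_fst[OF y1] x] e.R_I1[OF x y1 G[simplified] id_refl[OF e.X x]]
    show "\<Delta> \<TTurnstile> ren \<rho> ?S" by simp }
  { assume "\<Delta> \<TTurnstile> ren \<rho> (Neg (isG X Y f g (App g y)))"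
    then have N: "\<Delta> \<TTurnstile> Neg (isG (ren \<rho> X) (ren \<rho> Y) (ren \<rho> f) (ren \<rho> g) (App (ren \<rho> g) (ren \<rho> y)))" by simp
    obtain x where x: "\<Delta> \<turnstile> x \<Ztypecolon> ren \<rho> X" and p: "\<Delta> \<TTurnstile> TId (ren \<rho> Y) (App (ren \<rho> f) x) (ren \<rho> y)"
      by (rule e.f_fiber_of_not_isG_g[OF y1 N])
    from inh_sig_I[OF e.R_form_fst[OF y1] x] e.R_I2[OF x y1 e.not_isG_of_not_isG_g[OF y1 N x p] p]
    show "\<Delta> \<TTurnstile> ren \<rho> ?S" by simp }
qed

text \<open>Let \<open>h\<close> and \<open>j\<close> choose partners of the points of \<open>X\<close> and \<open>Y\<close>. Both \<open>y\<close> and \<open>h (j y)\<close> are partners of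
  \<open>j y\<close>, so they are equal; both \<open>x\<close> and \<open>j (h x)\<close> are partners of \<open>h x\<close>.\<close>
lemma equiv: "\<Gamma> \<TTurnstile> Equiv X Y"
proof -
  interpret x: embedding_pair "X # \<Gamma>" k "\<up>X" "\<up>Y" "\<up>f" "\<up>g" by (rule ext[OF X])
  interpret y: embedding_pair "Y # \<Gamma>" k "\<up>X" "\<up>Y" "\<up>f" "\<up>g" by (rule ext[OF Y])
  note vx = var0[OF X] and vy = var0[OF Y]
  obtain h where h: "\<Gamma> \<turnstile> h \<Ztypecolon> Arr X Y"
    and hR: "X # \<Gamma> \<TTurnstile> CB \<up>X \<up>Y \<up>f \<up>g (Var 0) (App \<up>h (Var 0))"
    by (rule choice[OF X Y x.R_form_snd[OF vx] x.R_total[OF vx]]) simp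
  obtain j where j: "\<Gamma> \<turnstile> j \<Ztypecolon> Arr Y X"
    and jR: "Y # \<Gamma> \<TTurnstile> CB \<up>X \<up>Y \<up>f \<up>g (App \<up>j (Var 0)) (Var 0)"
    by (rule choice[OF Y X y.R_form_fst[OF vy] y.R_cototal[OF vy]]) simp
  have hx: "X # \<Gamma> \<turnstile> App \<up>h (Var 0) \<Ztypecolon> \<up>Y" using app_var0[OF X h[unfolded Arr_def]] by simp
  have jy: "Y # \<Gamma> \<turnstile> App \<up>j (Var 0) \<Ztypecolon> \<up>X" using app_var0[OF Y j[unfolded Arr_def]] by simp
  have hjy: "Y # \<Gamma> \<turnstile> App \<up>h (App \<up>j (Var 0)) \<Ztypecolon> \<up>Y"
    using app_typ[OF weaken[OF h Y, simplified] jy] .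
  have jhx: "X # \<Gamma> \<turnstile> App \<up>j (App \<up>h (Var 0)) \<Ztypecolon> \<up>X"
    using app_typ[OF weaken[OF j X, simplified] hx] .
  have "Y # \<Gamma> \<TTurnstile> CB \<up>X \<up>Y \<up>f \<up>g (App \<up>j (Var 0)) (App \<up>h (App \<up>j (Var 0)))"
    using inh_pi_E[OF inh_weaken[OF inh_pi_I[OF hR] Y, simplified] jy] by simp
  then have "Y # \<Gamma> \<TTurnstile> TId \<up>Y (App \<up>h (App \<up>j (Var 0))) (Var 0)"
    using y.R_functional[OF jy hjy vy] jR by simp
  moreover have "X # \<Gamma> \<TTurnstile> CB \<up>X \<up>Y \<up>f \<up>g (App \<up>j (App \<up>h (Var 0))) (App \<up>h (Var 0))"
    using inh_pi_E[OF inh_weaken[OF inh_pi_I[OF jR] X, simplified] hx] by simp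
  then have "X # \<Gamma> \<TTurnstile> TId \<up>X (App \<up>j (App \<up>h (Var 0))) (Var 0)"
    using x.R_injective[OF jhx vx hx] hR by simp
  ultimately show ?thesis by (rule equiv_I[OF X Y h j])
qed

end

lemma cantor_bernstein_inh:
  assumes X: "\<Gamma> \<turnstile> X \<Ztypecolon> Univ k" and Y: "\<Gamma> \<turnstile> Y \<Ztypecolon> Univ k" and LEM: "\<Gamma> \<TTurnstile> LEM k"
    and F: "\<Gamma> \<TTurnstile> Emb X Y" and G: "\<Gamma> \<TTurnstile> Emb Y X"
  shows "\<Gamma> \<TTurnstile> Equiv X Y"
proof -
  obtain f where f: "\<Gamma> \<turnstile> f \<Ztypecolon> Arr X Y" "\<Gamma> \<TTurnstile> isEmb X Y f"
    using inh_sig_E[OF F[unfolded Emb_def, simplified] Arr_form[OF X Y] Emb_form(2)[OF X Y]] by auto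
  obtain g where g: "\<Gamma> \<turnstile> g \<Ztypecolon> Arr Y X" "\<Gamma> \<TTurnstile> isEmb Y X g"
    using inh_sig_E[OF G[unfolded Emb_def, simplified] Arr_form[OF Y X] Emb_form(2)[OF Y X]] by auto
  interpret embedding_pair \<Gamma> k X Y f g by unfold_locales (rule X Y f g LEM)+
  show ?thesis by (rule equiv)
qed

text \<open>By cumulativity, \<open>X\<close> and \<open>Y\<close> both live in the universe \<open>max i j\<close> of excluded middle.\<close>
theorem theorem2p1:
  fixes i j :: nat
  shows "\<exists>t. [] \<turnstile> t \<Ztypecolon>
    Arr (LEM (max i j))
      (TPi (Univ i) (TPi (Univ j)
        (Arr (Emb (Var 1) (Var 0)) (Arr (Emb (Var 0) (Var 1)) (Equiv (Var 1) (Var 0))))))"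
proof -
  let ?k = "max i j"
  let ?\<Gamma> = "[Univ j, Univ i, LEM ?k]"
  note L = LEM_form[OF ctx_nil, of ?k]
  have i: "[LEM ?k] \<turnstile> Univ i \<Ztypecolon> Univ (Suc i)" by (rule univ[OF typing_ctx[OF var0[OF L]]])
  have j: "[Univ i, LEM ?k] \<turnstile> Univ j \<Ztypecolon> Univ (Suc j)" by (rule univ[OF typing_ctx[OF var0[OF i]]])
  have X: "?\<Gamma> \<turnstile> Var 1 \<Ztypecolon> Univ ?k"
    using cumul_le[OF weaken_type[OF var0[OF i, simplified] j]] by simp
  have Y: "?\<Gamma> \<turnstile> Var 0 \<Ztypecolon> Univ ?k"
    using cumul_le[OF var0[OF j, simplified]] by simp
  have lem: "?\<Gamma> \<TTurnstile> LEM ?k"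
    using inh_weaken[OF inh_weaken[OF inh_var0[OF L] i] j] by simp
  have "?\<Gamma> \<TTurnstile> Arr (Emb (Var 1) (Var 0)) (Arr (Emb (Var 0) (Var 1)) (Equiv (Var 1) (Var 0)))"
  proof (rule weakening_arr_I[OF Emb_form(1)[OF X Y]])
    fix \<Delta> \<rho>
    assume w: "weakens \<rho> ?\<Gamma> \<Delta>" and F: "\<Delta> \<TTurnstile> ren \<rho> (Emb (Var 1) (Var 0))"
    note X1 = weakens_type[OF w X] and Y1 = weakens_type[OF w Y]
    have "\<Delta> \<TTurnstile> Arr (ren \<rho> (Emb (Var 0) (Var 1))) (ren \<rho> (Equiv (Var 1) (Var 0)))"
    proof (rule weakening_arr_I)
      show "\<Delta> \<turnstile> ren \<rho> (Emb (Var 0) (Var 1)) \<Ztypecolon> Univ ?k"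
        by (rule weakens_type[OF w Emb_form(1)[OF Y X]])
      fix \<Theta> \<sigma>
      assume v: "weakens \<sigma> \<Delta> \<Theta>" and G: "\<Theta> \<TTurnstile> ren \<sigma> (ren \<rho> (Emb (Var 0) (Var 1)))"
      show "\<Theta> \<TTurnstile> ren \<sigma> (ren \<rho> (Equiv (Var 1) (Var 0)))"
        using cantor_bernstein_inh[OF weakens_type[OF v X1] weakens_type[OF v Y1]]
          weakens_inh[OF v weakens_inh[OF w lem]] weakens_inh[OF v F] G by simp
    qed
    then show "\<Delta> \<TTurnstile> ren \<rho> (Arr (Emb (Var 0) (Var 1)) (Equiv (Var 1) (Var 0)))" by simp
  qed
  then have "[] \<TTurnstile> Arr (LEM ?k) (TPi (Univ i) (TPi (Univ j)
        (Arr (Emb (Var 1) (Var 0)) (Arr (Emb (Var 0) (Var 1)) (Equiv (Var 1) (Var 0))))))"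
    by (intro inh_arr_I) (simp add: inh_pi_I)
  then show ?thesis by (simp add: inhabited_def)
qed

end
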